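(* Let $d\ge 2$ and $n\ge k\ge 0$ be integers, and consider a stabilizer code encoding $k$ qudits of dimension $d$ into $n$ qudits of dimension $d$, with stabilizer group $\mathbb{S}$ of order $d^{n-k}$ and set of pure errors $\mathbb{T}$. For $T\in\mathbb{T}$ let $\Pi_T = T\,\Pi_I\,T^\dagger$ be the projector onto the corresponding cospace, where $\Pi_I=\frac{1}{|\mathbb{S}|}\sum_{S\in\mathbb{S}}S$. Then, as linear maps on operators on $(\mathbb{C}^d)^{\otimes n}$, $$\frac{1}{|\mathbb{S}|}\sum_{S\in\mathbb{S}}\mathcal{A}(S)=\sum_{T\in\mathbb{T}}\mathcal{A}(\Pi_T),$$ where $\mathcal{A}(M)$ denotes the map $\rho\mapsto M\rho M^\dagger$. Equivalently, $\frac{1}{|\mathbb{S}|}\sum_{S\in\mathbb{S}}S\rho S^\dagger=\sum_{T\in\mathbb{T}}\Pi_T\,\rho\,\Pi_T$ for every linear operator $\rho$ on $(\mathbb{C}^d)^{\otimes n}$.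
   Context: Weyl operators: on $\mathbb{C}^d$ with basis $\{|j\rangle: j\in\mathbb{Z}_d\}$, let $X_d=\sum_{j\in\mathbb{Z}_d}|j+1\rangle\langle j|$ (addition modulo $d$) and $Z_d=\sum_{j\in\mathbb{Z}_d}e^{2\pi i j/d}|j\rangle\langle j|$. The set of $n$-qudit Weyl operators is $\mathbb{PW}_{d,n}=\{X_d^xZ_d^z: x,z\in\mathbb{Z}_d^n\}$, where $X_d^x=\bigotimes_{i}X_d^{x_i}$ and $Z_d^z=\bigotimes_i Z_d^{z_i}$; it is closed under multiplication up to phases, and any two Weyl operators commute up to a $d$th root of unity. Stabilizer code: the stabilizer group $\mathbb{S}$ is an Abelian group (under operator multiplication) whose elements are phase multiples of operators in $\mathbb{PW}_{d,n}$, which contains no nontrivial phase multiple of the identity, and which has order $|\mathbb{S}|=d^{n-k}$. The codespace is the joint $+1$ eigenspace of $\mathbb{S}$, and $\Pi_I$ is the orthogonal projector onto it. Cospaces and pure errors: the simultaneous eigenspaces of $\mathbb{S}$ (equivalently, of a generating set of $\mathbb{S}$) are mutually orthogonal subspaces of $(\mathbb{C}^d)^{\otimes n}$. The pure errors $\mathbb{T}\subset\mathbb{PW}_{d,n}$ form a group (up to phases) of Weyl operators labelling these eigenspaces: every simultaneous eigenspace of $\mathbb{S}$ is the image under $T$ of the codespace for exactly one $T\in\mathbb{T}$ (so $|\mathbb{T}|=|\mathbb{S}|$). The orthogonal projector onto the eigenspace labelled by $T$ is $\Pi_T=T\Pi_IT^\dagger$. *)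

theory Defs
  imports Complex_Main "Jordan_Normal_Form.Schur_Decomposition"
begin

text \<open>
  Operators on the \<open>n\<close>-fold tensor power of \<open>\<complex>\<^sup>d\<close> are complex \<open>d ^ n \<times> d ^ n\<close> matrices with respect
  to the product basis, ordered lexicographically; the tensor product of matrices is the
  Kronecker product. Elements of \<open>\<int>\<^sub>d\<^sup>n\<close> are lists of length \<open>n\<close> over the representatives
  \<open>0, \<dots>, d - 1\<close>.
\<close>

abbreviation op_ring :: "nat \<Rightarrow> nat \<Rightarrow> complex mat ring" where
  "op_ring d n \<equiv> ring_mat TYPE(complex) (d ^ n) ()"

definition kron :: "complex mat \<Rightarrow> complex mat \<Rightarrow> complex mat" where
  "kron A B = mat (dim_row A * dim_row B) (dim_col A * dim_col B)
     (\<lambda>(i, j). A $$ (i div dim_row B, j div dim_col B) * B $$ (i mod dim_row B, j mod dim_col B))"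

definition tensor_list :: "complex mat list \<Rightarrow> complex mat" where
  "tensor_list As = foldr kron As (1\<^sub>m 1)"

definition shift_op :: "nat \<Rightarrow> complex mat" where
  "shift_op d = mat d d (\<lambda>(i, j). if i = (j + 1) mod d then 1 else 0)"

definition clock_op :: "nat \<Rightarrow> complex mat" where
  "clock_op d = mat d d (\<lambda>(i, j). if i = j then exp (2 * of_real pi * \<i> * of_nat j / of_nat d) else 0)"

definition Zd_vecs :: "nat \<Rightarrow> nat \<Rightarrow> nat list set" where
  "Zd_vecs d n = {x. length x = n \<and> set x \<subseteq> {..<d}}"

definition weyl_op :: "nat \<Rightarrow> nat list \<Rightarrow> nat list \<Rightarrow> complex mat" where
  "weyl_op d x z = tensor_list (map (\<lambda>a. shift_op d ^\<^sub>m a) x) * tensor_list (map (\<lambda>b. clock_op d ^\<^sub>m b) z)"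

definition PW :: "nat \<Rightarrow> nat \<Rightarrow> complex mat set" where
  "PW d n = {weyl_op d x z | x z. x \<in> Zd_vecs d n \<and> z \<in> Zd_vecs d n}"

definition phase_multiples :: "complex mat set \<Rightarrow> complex mat set" where
  "phase_multiples A = {c \<cdot>\<^sub>m M | c M. cmod c = 1 \<and> M \<in> A}"

definition stabilizer_group :: "nat \<Rightarrow> nat \<Rightarrow> nat \<Rightarrow> complex mat set \<Rightarrow> bool" where
  "stabilizer_group d n k SS \<longleftrightarrow>
     SS \<subseteq> phase_multiples (PW d n) \<and>
     comm_group (op_ring d n\<lparr>carrier := SS\<rparr>) \<and>
     (\<forall>c. cmod c = 1 \<and> c \<cdot>\<^sub>m 1\<^sub>m (d ^ n) \<in> SS \<longrightarrow> c = 1) \<and>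
     card SS = d ^ (n - k)"

definition joint_eigenspace ::
  "nat \<Rightarrow> nat \<Rightarrow> complex mat set \<Rightarrow> (complex mat \<Rightarrow> complex) \<Rightarrow> complex vec set" where
  "joint_eigenspace d n SS \<chi> = {v \<in> carrier_vec (d ^ n). \<forall>S\<in>SS. S *\<^sub>v v = \<chi> S \<cdot>\<^sub>v v}"

definition codespace :: "nat \<Rightarrow> nat \<Rightarrow> complex mat set \<Rightarrow> complex vec set" where
  "codespace d n SS = joint_eigenspace d n SS (\<lambda>_. 1)"

definition cospaces :: "nat \<Rightarrow> nat \<Rightarrow> complex mat set \<Rightarrow> complex vec set set" where
  "cospaces d n SS = range (joint_eigenspace d n SS) - {{0\<^sub>v (d ^ n)}}"

text \<open>
  The elements of \<open>PW d n\<close> carry fixed phases, so \<open>TT\<close> itself need not be closed under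
  multiplication; being a group up to phases means that its phase multiples form a group.
\<close>

definition pure_errors :: "nat \<Rightarrow> nat \<Rightarrow> complex mat set \<Rightarrow> complex mat set \<Rightarrow> bool" where
  "pure_errors d n SS TT \<longleftrightarrow>
     TT \<subseteq> PW d n \<and>
     group (op_ring d n\<lparr>carrier := phase_multiples TT\<rparr>) \<and>
     (\<forall>E \<in> cospaces d n SS. \<exists>!T. T \<in> TT \<and> E = (\<lambda>v. T *\<^sub>v v) ` codespace d n SS)"

definition code_proj :: "nat \<Rightarrow> nat \<Rightarrow> complex mat set \<Rightarrow> complex mat" where
  "code_proj d n SS = (1 / of_nat (card SS)) \<cdot>\<^sub>m (\<Oplus>\<^bsub>op_ring d n\<^esub>S\<in>SS. S)"

definition cospace_proj :: "nat \<Rightarrow> nat \<Rightarrow> complex mat set \<Rightarrow> complex mat \<Rightarrow> complex mat" where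
  "cospace_proj d n SS T = T * code_proj d n SS * mat_adjoint T"

definition conj_map :: "complex mat \<Rightarrow> complex mat \<Rightarrow> complex mat" where
  "conj_map M \<rho> = M * \<rho> * mat_adjoint M"

end

theory Submission
  imports Defs
begin

text \<open>
  Write \<open>T S = \<chi> T S \<cdot> S T\<close> for the commutation phase of a Weyl operator with a stabilizer, so that
  \<open>\<Pi>\<^sub>T = (1 / |SS|) \<Sum>\<^sub>S \<chi> T S \<cdot> S\<close>. Expanding \<open>\<Sum>\<^sub>T \<Pi>\<^sub>T \<rho> \<Pi>\<^sub>T\<^sup>\<dagger>\<close> reduces the theorem to the orthogonality
  relation \<open>\<Sum>\<^sub>T \<chi> T S \<cdot> cnj (\<chi> T S') = |SS|\<close> if \<open>S = S'\<close> and \<open>0\<close> otherwise. Every Weyl operator \<open>W\<close> maps the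
  codespace (nonzero, because a stabilizer other than the identity has trace 0) onto a cospace, so some
  pure error has the same commutation phases as \<open>W\<close>. Since a Weyl operator that is not the identity fails to
  commute with some other Weyl operator, the characters \<open>\<chi> T\<close> separate the stabilizers; as the pure errors
  are closed under multiplication up to phases, the sums over \<open>T\<close> vanish for \<open>S \<noteq> S'\<close>.
\<close>

subsection \<open>Adjoints and entrywise sums\<close>

lemma dim_mat_adjoint [simp]:
  "dim_row (mat_adjoint A) = dim_col A" "dim_col (mat_adjoint A) = dim_row A"
  by (auto simp: mat_adjoint_def)

lemma mat_adjoint_index [simp]:
  fixes A :: "complex mat"
  assumes "i < dim_col A" "j < dim_row A"
  shows "mat_adjoint A $$ (i, j) = cnj (A $$ (j, i))"
  using assms by (auto simp: mat_adjoint_def mat_of_rows_def)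

lemma mat_adjoint_carrier [simp]:
  "A \<in> carrier_mat m n \<Longrightarrow> mat_adjoint A \<in> carrier_mat n m"
  by (rule carrier_matI) (simp_all only: dim_mat_adjoint carrier_matD)

lemma mat_adjoint_mult:
  fixes A B :: "complex mat"
  assumes "dim_col A = dim_row B"
  shows "mat_adjoint (A * B) = mat_adjoint B * mat_adjoint A"
proof (rule eq_matI)
  fix i j assume "i < dim_row (mat_adjoint B * mat_adjoint A)" "j < dim_col (mat_adjoint B * mat_adjoint A)"
  then have "i < dim_col B" "j < dim_row A" by simp_all
  then show "mat_adjoint (A * B) $$ (i, j) = (mat_adjoint B * mat_adjoint A) $$ (i, j)"
    using assms by (simp add: scalar_prod_def mult.commute)
qed simp_all

lemma mat_adjoint_smult:
  "mat_adjoint (c \<cdot>\<^sub>m (A :: complex mat)) = cnj c \<cdot>\<^sub>m mat_adjoint A"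
  by (intro eq_matI) auto

lemma mat_adjoint_adjoint [simp]: "mat_adjoint (mat_adjoint (A :: complex mat)) = A"
  by (intro eq_matI) auto

lemma mat_adjoint_one [simp]: "mat_adjoint (1\<^sub>m n :: complex mat) = 1\<^sub>m n"
  by (intro eq_matI) auto

text \<open>Fixing one dimension \<open>N\<close> lets the simplifier discharge the carrier
  conditions. Products are then nested to the right and scalars move to the front.\<close>

lemmas square_mat_simps =
  assoc_mult_mat[of _ N N _ N _ N] mult_carrier_mat[of _ N N _ N]
  mult_smult_distrib[of _ N N _ N] mult_smult_assoc_mat[of _ N N _ N] for N

lemma smult_smult_mat [simp]:
  fixes A :: "'a :: semigroup_mult mat"
  shows "a \<cdot>\<^sub>m (b \<cdot>\<^sub>m A) = (a * b) \<cdot>\<^sub>m A"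
  by (intro eq_matI) (auto simp: mult.assoc)

lemma one_smult_mat [simp]: "(1 :: 'a :: monoid_mult) \<cdot>\<^sub>m A = A"
  by (intro eq_matI) auto

lemma smult_mult_mat_vec:
  fixes A :: "'a :: comm_semiring_0 mat"
  assumes "A \<in> carrier_mat m n" "v \<in> carrier_vec n"
  shows "(c \<cdot>\<^sub>m A) *\<^sub>v v = c \<cdot>\<^sub>v (A *\<^sub>v v)"
  using assms by (intro eq_vecI) auto

lemma mult_mat_index_sum:
  assumes "A \<in> carrier_mat m n" "B \<in> carrier_mat n p" "i < m" "j < p"
  shows "(A * B) $$ (i, j) = (\<Sum>k = 0..<n. A $$ (i, k) * B $$ (k, j))"
  using assms by (auto simp: scalar_prod_def)

text \<open>Passing to entries turns \<open>finsum\<close> in the matrix ring into ordinary complex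
  sums, which can be swapped, factored and reindexed.\<close>

lemma finsum_ring_mat:
  fixes f :: "'a \<Rightarrow> complex mat"
  assumes "finite A" "\<And>a. a \<in> A \<Longrightarrow> f a \<in> carrier_mat N N"
  shows finsum_ring_mat_carrier: "finsum (ring_mat TYPE(complex) N b) f A \<in> carrier_mat N N"
    and finsum_ring_mat_index: "\<And>i j. i < N \<Longrightarrow> j < N \<Longrightarrow>
      finsum (ring_mat TYPE(complex) N b) f A $$ (i, j) = (\<Sum>a\<in>A. f a $$ (i, j))"
proof -
  interpret ring "ring_mat TYPE(complex) N b" by (rule ring_mat)
  \<comment> \<open>Both claims go through one induction: reading off an entry of the sum over
    \<open>insert x F\<close> requires that the sum over \<open>F\<close> already has the right
    dimensions.\<close>
  have "finsum (ring_mat TYPE(complex) N b) f A \<in> carrier_mat N N \<and>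
    (\<forall>i<N. \<forall>j<N. finsum (ring_mat TYPE(complex) N b) f A $$ (i, j) = (\<Sum>a\<in>A. f a $$ (i, j)))"
    using assms
  proof (induction A rule: finite_induct)
    case empty
    then show ?case by (simp add: ring_mat_simps)
  next
    case (insert x F)
    have f: "f \<in> F \<rightarrow> carrier (ring_mat TYPE(complex) N b)" "f x \<in> carrier (ring_mat TYPE(complex) N b)"
      using insert.prems by (auto simp: ring_mat_simps)
    show ?case
      using insert f by (simp add: finsum_insert) (auto simp: ring_mat_simps)
  qed
  then show "finsum (ring_mat TYPE(complex) N b) f A \<in> carrier_mat N N"
    "\<And>i j. i < N \<Longrightarrow> j < N \<Longrightarrow>
      finsum (ring_mat TYPE(complex) N b) f A $$ (i, j) = (\<Sum>a\<in>A. f a $$ (i, j))" by auto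
qed

lemma mult_finsum_index:
  fixes f :: "'a \<Rightarrow> complex mat"
  assumes "finite A" "\<And>a. a \<in> A \<Longrightarrow> f a \<in> carrier_mat N N" "M \<in> carrier_mat N N" "i < N" "j < N"
  shows "(M * finsum (ring_mat TYPE(complex) N b) f A) $$ (i, j) = (\<Sum>a\<in>A. (M * f a) $$ (i, j))"
proof -
  have "(\<Sum>a\<in>A. (M * f a) $$ (i, j)) = (\<Sum>a\<in>A. \<Sum>k = 0..<N. M $$ (i, k) * f a $$ (k, j))"
    using assms by (intro sum.cong mult_mat_index_sum) auto
  also have "\<dots> = (\<Sum>k = 0..<N. M $$ (i, k) * (\<Sum>a\<in>A. f a $$ (k, j)))"
    by (subst sum.swap) (simp add: sum_distrib_left)
  also have "\<dots> = (\<Sum>k = 0..<N. M $$ (i, k) * finsum (ring_mat TYPE(complex) N b) f A $$ (k, j))"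
    using assms by (intro sum.cong refl) (simp add: finsum_ring_mat_index)
  also have "\<dots> = (M * finsum (ring_mat TYPE(complex) N b) f A) $$ (i, j)"
    by (rule mult_mat_index_sum[symmetric]) (use assms finsum_ring_mat_carrier[of A f N b] in auto)
  finally show ?thesis ..
qed

section \<open>Conjugation in matrix entries\<close>

lemma conj_map_carrier:
  "M \<in> carrier_mat N N \<Longrightarrow> \<rho> \<in> carrier_mat N N \<Longrightarrow> conj_map M \<rho> \<in> carrier_mat N N"
  unfolding conj_map_def by (intro mult_carrier_mat[of _ N N] mat_adjoint_carrier)

text \<open>The entries of \<rho> occur linearly, with coefficients quadratic in \<open>M\<close>.
  Two sums of such maps therefore agree once their coefficients agree for all indices.\<close>

lemma conj_map_index:
  assumes "M \<in> carrier_mat N N" "\<rho> \<in> carrier_mat N N" "i < N" "j < N"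
  shows "conj_map M \<rho> $$ (i, j) = (\<Sum>k = 0..<N. \<Sum>l = 0..<N. M $$ (i, k) * \<rho> $$ (k, l) * cnj (M $$ (j, l)))"
proof -
  have "conj_map M \<rho> $$ (i, j) = (\<Sum>l = 0..<N. (M * \<rho>) $$ (i, l) * mat_adjoint M $$ (l, j))"
    unfolding conj_map_def using assms by (intro mult_mat_index_sum mult_carrier_mat[of _ N N]) auto
  also have "\<dots> = (\<Sum>l = 0..<N. (\<Sum>k = 0..<N. M $$ (i, k) * \<rho> $$ (k, l)) * cnj (M $$ (j, l)))"
    using assms mult_mat_index_sum[of M N N \<rho> N i]
    by (intro sum.cong arg_cong2[where f = "(*)"] refl) auto
  also have "\<dots> = (\<Sum>k = 0..<N. \<Sum>l = 0..<N. M $$ (i, k) * \<rho> $$ (k, l) * cnj (M $$ (j, l)))"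
    by (subst sum.swap) (simp only: sum_distrib_right)
  finally show ?thesis .
qed

subsection \<open>Unitary operators and commutation up to a phase\<close>

definition unitary_op :: "nat \<Rightarrow> complex mat \<Rightarrow> bool" where
  "unitary_op N A \<longleftrightarrow> A \<in> carrier_mat N N \<and> A * mat_adjoint A = 1\<^sub>m N \<and> mat_adjoint A * A = 1\<^sub>m N"

text \<open>A one-sided inverse of a square matrix is two-sided.\<close>

lemma unitary_opI:
  assumes "A \<in> carrier_mat N N" "mat_adjoint A * A = 1\<^sub>m N"
  shows "unitary_op N A"
  using assms mat_mult_left_right_inverse[OF mat_adjoint_carrier[OF assms(1)] assms]
  by (simp add: unitary_op_def)

lemma unitary_op_carrier: "unitary_op N A \<Longrightarrow> A \<in> carrier_mat N N"
  by (simp add: unitary_op_def)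

lemma unitary_op_one [simp]: "unitary_op N (1\<^sub>m N)"
  by (simp add: unitary_op_def)

lemma cmod_one_cnj_mult: "cmod c = 1 \<Longrightarrow> cnj c * c = 1" "cmod c = 1 \<Longrightarrow> c * cnj c = 1"
  by (simp_all add: complex_norm_square[symmetric] mult.commute[of "cnj c"])

lemma unitary_op_smult:
  assumes "cmod c = 1" "unitary_op N A"
  shows "unitary_op N (c \<cdot>\<^sub>m A)"
  using assms
  by (simp add: unitary_op_def mat_adjoint_smult square_mat_simps[where N = N] cmod_one_cnj_mult)

lemma unitary_op_mult:
  assumes "unitary_op N A" "unitary_op N B"
  shows "unitary_op N (A * B)"
proof -
  have c: "A \<in> carrier_mat N N" "B \<in> carrier_mat N N"
    "mat_adjoint A \<in> carrier_mat N N" "mat_adjoint B \<in> carrier_mat N N"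
    using assms by (auto simp: unitary_op_def)
  have "(A * B) * (mat_adjoint B * mat_adjoint A) = A * (B * mat_adjoint B) * mat_adjoint A"
    using c by (simp add: square_mat_simps[where N = N])
  moreover have "(mat_adjoint B * mat_adjoint A) * (A * B) = mat_adjoint B * (mat_adjoint A * A) * B"
    using c by (simp add: square_mat_simps[where N = N])
  moreover have "dim_col A = dim_row B" using c(1,2) by (metis carrier_matD)
  ultimately show ?thesis
    using assms c by (simp add: unitary_op_def mat_adjoint_mult)
qed

lemma unitary_op_pow: "unitary_op N A \<Longrightarrow> unitary_op N (A ^\<^sub>m m)"
  by (induction m) (auto simp: unitary_op_mult dest: unitary_op_carrier)

lemma unitary_op_ne_zero:
  assumes "unitary_op N A" "N > 0"
  shows "A \<noteq> 0\<^sub>m N N"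
proof
  assume "A = 0\<^sub>m N N"
  then have "1\<^sub>m N = (0\<^sub>m N N :: complex mat)" using assms by (simp add: unitary_op_def)
  then have "1\<^sub>m N $$ (0,0) = (0\<^sub>m N N :: complex mat) $$ (0,0)" by simp
  with \<open>N > 0\<close> show False by simp
qed

text \<open>The phase is an explicit argument so that phases can be multiplied along products. The
  order of the operators matters: exchanging them conjugates a unimodular phase.\<close>

definition commute_up_to :: "complex \<Rightarrow> complex mat \<Rightarrow> complex mat \<Rightarrow> bool" where
  "commute_up_to c A B \<longleftrightarrow> A * B = c \<cdot>\<^sub>m (B * A)"

lemma commute_up_to_mult_right:
  assumes c: "A \<in> carrier_mat N N" "B \<in> carrier_mat N N" "B' \<in> carrier_mat N N"
    and "commute_up_to c A B" "commute_up_to c' A B'"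
  shows "commute_up_to (c * c') A (B * B')"
proof -
  have "A * (B * B') = (A * B) * B'" using c by (simp add: square_mat_simps[where N = N])
  also have "\<dots> = c \<cdot>\<^sub>m (B * (A * B'))"
    using assms(4) c by (simp add: commute_up_to_def square_mat_simps[where N = N])
  also have "\<dots> = (c * c') \<cdot>\<^sub>m ((B * B') * A)"
    using assms(5) c by (simp add: commute_up_to_def square_mat_simps[where N = N])
  finally show ?thesis by (simp add: commute_up_to_def)
qed

lemma commute_up_to_mult_left:
  assumes c: "A \<in> carrier_mat N N" "A' \<in> carrier_mat N N" "B \<in> carrier_mat N N"
    and "commute_up_to c A B" "commute_up_to c' A' B"
  shows "commute_up_to (c * c') (A * A') B"
proof -
  have "(A * A') * B = A * (A' * B)" using c by (simp add: square_mat_simps[where N = N])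
  also have "\<dots> = c' \<cdot>\<^sub>m ((A * B) * A')"
    using assms(5) c by (simp add: commute_up_to_def square_mat_simps[where N = N])
  also have "\<dots> = (c * c') \<cdot>\<^sub>m (B * (A * A'))"
    using assms(4) c by (simp add: commute_up_to_def square_mat_simps[where N = N] mult.commute)
  finally show ?thesis by (simp add: commute_up_to_def)
qed

lemma commute_up_to_sym:
  assumes "cmod c = 1" "commute_up_to c A B"
  shows "commute_up_to (cnj c) B A"
  using assms by (simp add: commute_up_to_def cmod_one_cnj_mult)

lemma commute_up_to_smult_right:
  assumes "A \<in> carrier_mat N N" "B \<in> carrier_mat N N" "commute_up_to c A B"
  shows "commute_up_to c A (a \<cdot>\<^sub>m B)"
  using assms by (simp add: commute_up_to_def square_mat_simps[where N = N] mult.commute)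

lemma commute_up_to_smult_left:
  assumes "A \<in> carrier_mat N N" "B \<in> carrier_mat N N" "commute_up_to c A B"
  shows "commute_up_to c (a \<cdot>\<^sub>m A) B"
  using assms by (simp add: commute_up_to_def square_mat_simps[where N = N] mult.commute)

lemma commute_up_to_one_right: "A \<in> carrier_mat N N \<Longrightarrow> commute_up_to 1 A (1\<^sub>m N)"
  by (auto simp: commute_up_to_def)

lemma commute_up_to_one_left: "A \<in> carrier_mat N N \<Longrightarrow> commute_up_to 1 (1\<^sub>m N) A"
  by (auto simp: commute_up_to_def)

lemma commute_up_to_self: "commute_up_to 1 A A"
  by (auto simp: commute_up_to_def)

lemma commute_up_to_pow_right:
  assumes "A \<in> carrier_mat N N" "B \<in> carrier_mat N N" "commute_up_to c A B"
  shows "commute_up_to (c ^ m) A (B ^\<^sub>m m)"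
proof (induction m)
  case 0
  with assms commute_up_to_one_right[of A N] show ?case by simp
next
  case (Suc m)
  with assms commute_up_to_mult_right[OF _ _ _ Suc assms(3), of N]
  show ?case by (simp add: mult.commute)
qed

text \<open>The product \<open>B * A\<close> is unitary, hence nonzero for \<open>N > 0\<close>, so
  two different scalars cannot give the same multiple of it. This makes the commutation phase well
  defined.\<close>

lemma commute_up_to_unique:
  assumes "unitary_op N A" "unitary_op N B" "N > 0" "commute_up_to c A B" "commute_up_to c' A B"
  shows "c = c'"
proof (rule ccontr)
  assume "c \<noteq> c'"
  have u: "unitary_op N (B * A)" using assms by (simp add: unitary_op_mult)
  have "B * A = 0\<^sub>m N N"
  proof (intro eq_matI)
    fix i j assume "i < dim_row (0\<^sub>m N N)" "j < dim_col (0\<^sub>m N N)"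
    then have ij: "i < dim_row (B * A)" "j < dim_col (B * A)"
      using unitary_op_carrier[OF u] by auto
    have "c \<cdot>\<^sub>m (B * A) = c' \<cdot>\<^sub>m (B * A)" using assms by (simp add: commute_up_to_def)
    then have "(c \<cdot>\<^sub>m (B * A)) $$ (i,j) = (c' \<cdot>\<^sub>m (B * A)) $$ (i,j)" by simp
    then have "c * (B * A) $$ (i,j) = c' * (B * A) $$ (i,j)"
      using ij by (simp del: index_mult_mat)
    then show "(B * A) $$ (i, j) = 0\<^sub>m N N $$ (i, j)"
      using \<open>c \<noteq> c'\<close> \<open>i < dim_row (0\<^sub>m N N)\<close> \<open>j < dim_col (0\<^sub>m N N)\<close>
      by (simp del: index_mult_mat)
  qed (use unitary_op_carrier[OF u] in auto)
  with unitary_op_ne_zero[OF u \<open>N > 0\<close>] show False by simp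
qed

subsection \<open>Kronecker products\<close>

text \<open>Writing \<open>k = i * n + j\<close> splits an index of a Kronecker product into the
  indices of its two factors.\<close>

lemma sum_prod_div_mod:
  fixes f :: "nat \<Rightarrow> nat \<Rightarrow> 'a :: comm_monoid_add"
  shows "(\<Sum>k = 0..<m * n. f (k div n) (k mod n)) = (\<Sum>i = 0..<m. \<Sum>j = 0..<n. f i j)"
proof -
  have "(\<Sum>k = 0..<m * n. f (k div n) (k mod n)) = (\<Sum>(i, j)\<in>{0..<m} \<times> {0..<n}. f i j)"
  proof (rule sum.reindex_bij_witness[where i = "\<lambda>(i, j). i * n + j" and j = "\<lambda>k. (k div n, k mod n)"])
    fix a assume a: "a \<in> {0..<m * n}"
    then have "n > 0" by (cases n) auto
    with a show "(a div n, a mod n) \<in> {0..<m} \<times> {0..<n}"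
      by (auto simp: less_mult_imp_div_less)
  next
    fix b assume "b \<in> {0..<m} \<times> {0..<n}"
    then obtain i j where b: "b = (i, j)" "i < m" "j < n" by auto
    have "i * n + j < Suc i * n" using b by simp
    also have "\<dots> \<le> m * n" using b by (intro mult_right_mono) auto
    finally show "(case b of (i, j) \<Rightarrow> i * n + j) \<in> {0..<m * n}" using b by simp
  qed auto
  then show ?thesis by (simp add: sum.cartesian_product)
qed

lemma dim_kron [simp]:
  "dim_row (kron A B) = dim_row A * dim_row B" "dim_col (kron A B) = dim_col A * dim_col B"
  by (auto simp: kron_def)

lemma kron_carrier:
  "A \<in> carrier_mat m n \<Longrightarrow> B \<in> carrier_mat m' n' \<Longrightarrow> kron A B \<in> carrier_mat (m * m') (n * n')"
  by (rule carrier_matI) (simp_all only: dim_kron carrier_matD)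

text \<open>The mixed-product rule: once the inner index is split into quotient and remainder, the
  double sum factors into two scalar products.\<close>

lemma kron_mult:
  assumes "dim_col A = dim_row C" "dim_col B = dim_row D"
  shows "kron A B * kron C D = kron (A * C) (B * D)"
proof (intro eq_matI)
  fix i j assume "i < dim_row (kron (A * C) (B * D))" "j < dim_col (kron (A * C) (B * D))"
  then have ij: "i < dim_row A * dim_row B" "j < dim_col C * dim_col D" by auto
  then have pos: "dim_row B > 0" "dim_col D > 0" by (cases "dim_row B"; cases "dim_col D"; auto)+
  have b: "i div dim_row B < dim_row A" "i mod dim_row B < dim_row B"
    "j div dim_col D < dim_col C" "j mod dim_col D < dim_col D"
    using ij pos by (auto simp: less_mult_imp_div_less)
  let ?f = "\<lambda>k l. (A $$ (i div dim_row B, k) * C $$ (k, j div dim_col D)) *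
      (B $$ (i mod dim_row B, l) * D $$ (l, j mod dim_col D))"
  have "(kron A B * kron C D) $$ (i, j) =
      (\<Sum>k = 0..<dim_row C * dim_row D. ?f (k div dim_row D) (k mod dim_row D))"
    using ij assms by (auto simp: kron_def scalar_prod_def intro!: sum.cong)
  also have "\<dots> = (\<Sum>k = 0..<dim_row C. \<Sum>l = 0..<dim_row D. ?f k l)"
    by (rule sum_prod_div_mod)
  also have "\<dots> = kron (A * C) (B * D) $$ (i, j)"
    using ij b assms by (simp add: kron_def scalar_prod_def sum_product)
  finally show "(kron A B * kron C D) $$ (i, j) = kron (A * C) (B * D) $$ (i, j)" .
qed auto

lemma kron_smult_left: "kron (c \<cdot>\<^sub>m A) B = c \<cdot>\<^sub>m kron A B"
  by (intro eq_matI) (auto simp: kron_def less_mult_imp_div_less)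

lemma kron_smult_right: "kron A (c \<cdot>\<^sub>m B) = c \<cdot>\<^sub>m kron A B"
proof (intro eq_matI)
  fix i j assume "i < dim_row (c \<cdot>\<^sub>m kron A B)" "j < dim_col (c \<cdot>\<^sub>m kron A B)"
  then show "kron A (c \<cdot>\<^sub>m B) $$ (i, j) = (c \<cdot>\<^sub>m kron A B) $$ (i, j)"
    \<comment> \<open>If \<open>B\<close> has no rows or no columns there are no entries to compare.
      Otherwise the remainders are valid indices of \<open>B\<close>.\<close>
    by (cases "dim_row B"; cases "dim_col B") (auto simp: kron_def)
qed auto

lemma kron_adjoint: "mat_adjoint (kron A B) = kron (mat_adjoint A) (mat_adjoint B)"
proof (intro eq_matI)
  fix i j
  assume "i < dim_row (kron (mat_adjoint A) (mat_adjoint B))"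
    "j < dim_col (kron (mat_adjoint A) (mat_adjoint B))"
  then show "mat_adjoint (kron A B) $$ (i, j) = kron (mat_adjoint A) (mat_adjoint B) $$ (i, j)"
    by (cases "dim_row B"; cases "dim_col B") (auto simp: kron_def less_mult_imp_div_less)
qed auto

lemma kron_one: "kron (1\<^sub>m m) (1\<^sub>m n) = 1\<^sub>m (m * n)"
proof (intro eq_matI)
  fix i j assume ij: "i < dim_row (1\<^sub>m (m * n))" "j < dim_col (1\<^sub>m (m * n))"
  moreover have "i = j \<longleftrightarrow> i div n = j div n \<and> i mod n = j mod n"
    by (metis div_mult_mod_eq)
  ultimately show "kron (1\<^sub>m m) (1\<^sub>m n) $$ (i, j) = 1\<^sub>m (m * n) $$ (i, j)"
    by (cases n) (auto simp: kron_def less_mult_imp_div_less)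
qed auto

lemma unitary_op_kron:
  assumes "unitary_op m A" "unitary_op n B"
  shows "unitary_op (m * n) (kron A B)"
  using assms kron_carrier[of A m m B n n]
  by (auto simp: unitary_op_def kron_adjoint kron_mult kron_one)

lemma commute_up_to_kron:
  assumes "A \<in> carrier_mat m m" "A' \<in> carrier_mat m m" "B \<in> carrier_mat n n" "B' \<in> carrier_mat n n"
    and "commute_up_to c A A'" "commute_up_to c' B B'"
  shows "commute_up_to (c * c') (kron A B) (kron A' B')"
  using assms
  by (simp add: commute_up_to_def kron_mult kron_smult_left kron_smult_right mult.commute)

subsection \<open>Weyl operators\<close>

lemma shift_op_carrier [simp]: "shift_op d \<in> carrier_mat d d"
  by (simp add: shift_op_def)

lemma clock_op_carrier [simp]: "clock_op d \<in> carrier_mat d d"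
  by (simp add: clock_op_def)

text \<open>Injectivity of the cyclic successor, which makes the columns of the shift operator
  orthonormal.\<close>

lemma Suc_mod_eq_iff:
  assumes "i < d" "j < d"
  shows "Suc i mod d = Suc j mod d \<longleftrightarrow> i = j"
  using assms by (auto simp: mod_Suc split: if_splits)

lemma unitary_op_shift:
  assumes "d > 0"
  shows "unitary_op d (shift_op d)"
proof (rule unitary_opI)
  show "mat_adjoint (shift_op d) * shift_op d = 1\<^sub>m d"
  proof (rule eq_matI)
    fix i j assume "i < dim_row (1\<^sub>m d)" "j < dim_col (1\<^sub>m d)"
    then have ij: "i < d" "j < d" by auto
    \<comment> \<open>Column \<open>j\<close> of the shift has its only nonzero entry in row
      \<open>Suc j mod d\<close>, so this is the inner product of columns \<open>i\<close> and
      \<open>j\<close>.\<close>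
    have "(mat_adjoint (shift_op d) * shift_op d) $$ (i, j) =
       (\<Sum>k = 0..<d. if k = Suc j mod d then (if k = Suc i mod d then 1 else 0) else 0)"
      using ij by (simp add: scalar_prod_def shift_op_def del: sum.delta sum.delta') (intro sum.cong; auto)
    also have "\<dots> = 1\<^sub>m d $$ (i, j)"
      using ij by (auto simp: sum.delta Suc_mod_eq_iff)
    finally show "(mat_adjoint (shift_op d) * shift_op d) $$ (i, j) = 1\<^sub>m d $$ (i, j)" .
  qed (simp_all add: shift_op_def)
qed simp

text \<open>The powers of this number, written \<omega> below, are the eigenvalues of the clock
  operator. For \<open>d = 0\<close> division by zero gives the value 1.\<close>

definition root_of_unity :: "nat \<Rightarrow> complex" where
  "root_of_unity d = cis (2 * pi / d)"

lemma root_of_unity_pow: "root_of_unity d ^ j = cis (2 * pi * j / d)"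
  by (simp add: root_of_unity_def DeMoivre mult.commute)

lemma root_of_unity_pow_mod: "d > 0 \<Longrightarrow> root_of_unity d ^ (j mod d) = root_of_unity d ^ j"
proof -
  assume "d > 0"
  then have "root_of_unity d ^ d = 1" by (simp add: root_of_unity_pow)
  then have "root_of_unity d ^ (d * (j div d) + j mod d) = root_of_unity d ^ (j mod d)"
    by (simp only: power_add power_mult) simp
  then show ?thesis by simp
qed

lemma norm_root_of_unity [simp]: "cmod (root_of_unity d) = 1"
  by (simp add: root_of_unity_def)

text \<open>Primitivity of \<omega>, from the known enumeration of the \<open>d\<close> distinct
  roots of unity. It is what detects a nonzero exponent of a Weyl operator.\<close>

lemma root_of_unity_pow_eq_1_iff:
  assumes "a < d"
  shows "root_of_unity d ^ a = 1 \<longleftrightarrow> a = 0"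
proof
  assume "root_of_unity d ^ a = 1"
  moreover have "inj_on (\<lambda>k. cis (2 * pi * real k / real d)) {..<d}"
    using bij_betw_roots_unity[of d] assms by (auto simp: bij_betw_def)
  ultimately show "a = 0"
    using assms inj_onD[of "\<lambda>k. cis (2 * pi * real k / real d)" "{..<d}" a 0]
    by (simp add: root_of_unity_pow)
qed simp

lemma clock_op_eq: "clock_op d = mat d d (\<lambda>(i, j). if i = j then root_of_unity d ^ j else 0)"
proof -
  have "exp (2 * of_real pi * \<i> * of_nat j / of_nat d) = root_of_unity d ^ j" for j
    by (simp add: root_of_unity_pow cis_conv_exp mult_ac)
  then show ?thesis unfolding clock_op_def by (simp only:)
qed

lemma unitary_op_clock: "unitary_op d (clock_op d)"
proof (rule unitary_opI)
  show "mat_adjoint (clock_op d) * clock_op d = 1\<^sub>m d"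
  proof (rule eq_matI)
    fix i j assume "i < dim_row (1\<^sub>m d)" "j < dim_col (1\<^sub>m d)"
    then have ij: "i < d" "j < d" by auto
    have "(mat_adjoint (clock_op d) * clock_op d) $$ (i, j) =
       (\<Sum>k = 0..<d. if k = j then (if k = i then cnj (root_of_unity d ^ k) * root_of_unity d ^ k else 0) else 0)"
      using ij by (simp add: scalar_prod_def clock_op_eq del: sum.delta sum.delta') (intro sum.cong; auto)
    also have "\<dots> = 1\<^sub>m d $$ (i, j)"
      using ij cmod_one_cnj_mult(1)[of "root_of_unity d ^ i"] by (auto simp: sum.delta norm_power)
    finally show "(mat_adjoint (clock_op d) * clock_op d) $$ (i, j) = 1\<^sub>m d $$ (i, j)" .
  qed (simp_all add: clock_op_def)
qed simp

text \<open>Both products send the basis vector at \<open>j\<close> to a multiple of the one at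
  \<open>j + 1\<close>, with factors \<omega> to the \<open>j + 1\<close> and \<omega> to the
  \<open>j\<close>. The wrap-around at \<open>j = d - 1\<close> is harmless because the
  \<open>d\<close>th power of \<omega> is 1.\<close>

lemma commute_up_to_clock_shift:
  assumes "d > 0"
  shows "commute_up_to (root_of_unity d) (clock_op d) (shift_op d)"
  unfolding commute_up_to_def
proof (rule eq_matI)
  let ?w = "root_of_unity d"
  fix i j
  assume "i < dim_row (?w \<cdot>\<^sub>m (shift_op d * clock_op d))" "j < dim_col (?w \<cdot>\<^sub>m (shift_op d * clock_op d))"
  then have ij: "i < d" "j < d" by (auto simp: shift_op_def clock_op_def)
  have "(clock_op d * shift_op d) $$ (i, j) =
     (\<Sum>k = 0..<d. if k = i then (if i = Suc j mod d then ?w ^ i else 0) else 0)"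
    unfolding mult_mat_index_sum[OF clock_op_carrier shift_op_carrier ij]
    using ij by (intro sum.cong) (auto simp: shift_op_def clock_op_eq)
  also have "\<dots> = ?w * (\<Sum>k = 0..<d. if k = j then (if i = Suc j mod d then ?w ^ j else 0) else 0)"
    using ij assms by (auto simp: sum.delta root_of_unity_pow_mod)
  also have "\<dots> = ?w * (shift_op d * clock_op d) $$ (i, j)"
    unfolding mult_mat_index_sum[OF shift_op_carrier clock_op_carrier ij]
    using ij by (intro arg_cong[where f = "(*) ?w"] sum.cong) (auto simp: shift_op_def clock_op_eq)
  finally show "(clock_op d * shift_op d) $$ (i, j) = (?w \<cdot>\<^sub>m (shift_op d * clock_op d)) $$ (i, j)"
    using ij by (simp add: shift_op_def clock_op_def)
qed (simp_all add: shift_op_def clock_op_def)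

lemma weyl_qudit_carrier [simp]: "shift_op d ^\<^sub>m a * clock_op d ^\<^sub>m b \<in> carrier_mat d d"
  by (rule mult_carrier_mat[of _ d d]) simp_all

text \<open>The clock commutes with its own powers and collects one factor \<omega> from each shift,
  so it detects the shift exponent \<open>a\<close>.\<close>

lemma commute_up_to_clock_weyl:
  assumes "d > 0"
  shows "commute_up_to (root_of_unity d ^ a) (clock_op d) (shift_op d ^\<^sub>m a * clock_op d ^\<^sub>m b)"
proof -
  have "commute_up_to (root_of_unity d ^ a) (clock_op d) (shift_op d ^\<^sub>m a)"
    using assms by (intro commute_up_to_pow_right[where N = d] commute_up_to_clock_shift) auto
  moreover have "commute_up_to (1 ^ b) (clock_op d) (clock_op d ^\<^sub>m b)"
    by (intro commute_up_to_pow_right[where N = d] commute_up_to_self) auto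
  ultimately have "commute_up_to (root_of_unity d ^ a * 1 ^ b) (clock_op d)
      (shift_op d ^\<^sub>m a * clock_op d ^\<^sub>m b)"
    by (intro commute_up_to_mult_right[where N = d]) auto
  then show ?thesis by simp
qed

text \<open>Dually, the shift detects the clock exponent \<open>b\<close>; the conjugate comes from
  reversing the order in the clock-shift relation.\<close>

lemma commute_up_to_shift_weyl:
  assumes "d > 0"
  shows "commute_up_to (cnj (root_of_unity d ^ b)) (shift_op d) (shift_op d ^\<^sub>m a * clock_op d ^\<^sub>m b)"
proof -
  have "commute_up_to (cnj (root_of_unity d)) (shift_op d) (clock_op d)"
    using assms by (intro commute_up_to_sym commute_up_to_clock_shift) auto
  then have "commute_up_to (cnj (root_of_unity d) ^ b) (shift_op d) (clock_op d ^\<^sub>m b)"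
    by (intro commute_up_to_pow_right[where N = d]) auto
  moreover have "commute_up_to (1 ^ a) (shift_op d) (shift_op d ^\<^sub>m a)"
    by (intro commute_up_to_pow_right[where N = d] commute_up_to_self) auto
  ultimately have "commute_up_to (1 ^ a * cnj (root_of_unity d) ^ b) (shift_op d)
      (shift_op d ^\<^sub>m a * clock_op d ^\<^sub>m b)"
    by (intro commute_up_to_mult_right[where N = d]) auto
  then show ?thesis by simp
qed

lemma commute_up_to_weyl_qudit:
  assumes "d > 0"
  shows "\<exists>c. cmod c = 1 \<and>
    commute_up_to c (shift_op d ^\<^sub>m a * clock_op d ^\<^sub>m b) (shift_op d ^\<^sub>m a' * clock_op d ^\<^sub>m b')"
proof -
  let ?W = "shift_op d ^\<^sub>m a * clock_op d ^\<^sub>m b" and ?w = "root_of_unity d"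
  have W: "?W \<in> carrier_mat d d" by auto
  have "commute_up_to (cnj (cnj (?w ^ b))) ?W (shift_op d)"
    by (rule commute_up_to_sym[OF _ commute_up_to_shift_weyl[OF assms]]) (simp add: norm_power)
  then have X: "commute_up_to (cnj (cnj (?w ^ b)) ^ a') ?W (shift_op d ^\<^sub>m a')"
    using W by (intro commute_up_to_pow_right[where N = d]) auto
  have "commute_up_to (cnj (?w ^ a)) ?W (clock_op d)"
    by (rule commute_up_to_sym[OF _ commute_up_to_clock_weyl[OF assms]]) (simp add: norm_power)
  then have Z: "commute_up_to (cnj (?w ^ a) ^ b') ?W (clock_op d ^\<^sub>m b')"
    using W by (intro commute_up_to_pow_right[where N = d]) auto
  \<comment> \<open>This phase is \<omega> to the power \<open>b * a' - a * b'\<close>, the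
    symplectic form of the two exponent pairs.\<close>
  have "commute_up_to (cnj (cnj (?w ^ b)) ^ a' * cnj (?w ^ a) ^ b') ?W (shift_op d ^\<^sub>m a' * clock_op d ^\<^sub>m b')"
    using W X Z by (intro commute_up_to_mult_right[where N = d]) auto
  moreover have "cmod (cnj (cnj (?w ^ b)) ^ a' * cnj (?w ^ a) ^ b') = 1"
    by (simp add: norm_mult norm_power)
  ultimately show ?thesis by blast
qed

section \<open>Weyl operators on several qudits\<close>

lemma tensor_list_simps [simp]:
  "tensor_list [] = 1\<^sub>m 1" "tensor_list (A # As) = kron A (tensor_list As)"
  by (simp_all add: tensor_list_def)

lemma tensor_list_carrier:
  "(\<And>A. A \<in> set As \<Longrightarrow> A \<in> carrier_mat d d) \<Longrightarrow> tensor_list As \<in> carrier_mat (d ^ length As) (d ^ length As)"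
  by (induction As) (simp_all add: kron_carrier)

lemma weyl_op_Nil [simp]: "weyl_op d [] [] = 1\<^sub>m 1"
  by (simp add: weyl_op_def)

text \<open>The mixed-product rule regroups the product of two tensor products qudit by qudit. This
  recursion drives all later inductions on the exponent lists.\<close>

lemma weyl_op_Cons:
  assumes "length x = length z"
  shows "weyl_op d (a # x) (b # z) = kron (shift_op d ^\<^sub>m a * clock_op d ^\<^sub>m b) (weyl_op d x z)"
proof -
  let ?X = "tensor_list (map (\<lambda>a. shift_op d ^\<^sub>m a) x)"
    and ?Z = "tensor_list (map (\<lambda>b. clock_op d ^\<^sub>m b) z)"
  have X: "?X \<in> carrier_mat (d ^ length x) (d ^ length x)"
    by (rule tensor_list_carrier[of "map (\<lambda>a. shift_op d ^\<^sub>m a) x" d, simplified length_map]) auto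
  have Z: "?Z \<in> carrier_mat (d ^ length z) (d ^ length z)"
    by (rule tensor_list_carrier[of "map (\<lambda>b. clock_op d ^\<^sub>m b) z" d, simplified length_map]) auto
  have "shift_op d ^\<^sub>m a \<in> carrier_mat d d" "clock_op d ^\<^sub>m b \<in> carrier_mat d d"
    by simp_all
  then have "dim_col (shift_op d ^\<^sub>m a) = dim_row (clock_op d ^\<^sub>m b)"
    by (metis carrier_matD)
  moreover have "dim_col ?X = dim_row ?Z"
    using X Z assms by (metis carrier_matD)
  ultimately show ?thesis
    by (simp add: weyl_op_def kron_mult)
qed

lemma unitary_op_weyl_qudit:
  assumes "d > 0"
  shows "unitary_op d (shift_op d ^\<^sub>m a * clock_op d ^\<^sub>m b)"
  by (intro unitary_op_mult unitary_op_pow unitary_op_shift unitary_op_clock assms)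

lemma unitary_op_weyl:
  assumes "length x = length z" "d > 0"
  shows "unitary_op (d ^ length x) (weyl_op d x z)"
  using assms(1) by (induction rule: list_induct2)
    (simp_all add: weyl_op_Cons unitary_op_kron unitary_op_weyl_qudit assms(2))

lemma weyl_op_commute:
  assumes "length x = length z" "length z = length x'" "length x' = length z'" "d > 0"
  shows "\<exists>c. cmod c = 1 \<and> commute_up_to c (weyl_op d x z) (weyl_op d x' z')"
  using assms(1-3)
proof (induction rule: list_induct4)
  case Nil
  show ?case by (auto intro: exI[of _ 1] simp: commute_up_to_self)
next
  case (Cons a x b z a' x' b' z')
  let ?A = "shift_op d ^\<^sub>m a * clock_op d ^\<^sub>m b" and ?A' = "shift_op d ^\<^sub>m a' * clock_op d ^\<^sub>m b'"
  obtain c where c: "cmod c = 1" "commute_up_to c (weyl_op d x z) (weyl_op d x' z')"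
    using Cons.IH by blast
  obtain c' where c': "cmod c' = 1" "commute_up_to c' ?A ?A'"
    using commute_up_to_weyl_qudit[OF assms(4)] by blast
  note u = unitary_op_carrier[OF unitary_op_weyl]
  have "commute_up_to (c' * c) (kron ?A (weyl_op d x z)) (kron ?A' (weyl_op d x' z'))"
    using c c' u[of x z d] u[of x' z' d] Cons.hyps assms(4)
    by (intro commute_up_to_kron[where m = d and n = "d ^ length x"]) auto
  then show ?case
    using Cons.hyps c(1) c'(1) by (intro exI[of _ "c' * c"]) (simp add: weyl_op_Cons norm_mult)
qed

lemma weyl_op_zero: "weyl_op d (replicate n 0) (replicate n 0) = 1\<^sub>m (d ^ n)"
  by (induction n) (simp_all add: weyl_op_Cons kron_one carrier_matD[OF shift_op_carrier]
      carrier_matD[OF clock_op_carrier])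

text \<open>Nondegeneracy of the symplectic form. At the first qudit with a nonzero exponent, a
  single clock (if \<open>a\<close> is nonzero) or a single shift (if only \<open>b\<close> is)
  fails to commute; all other qudits receive the identity. The exponent 1 is a legal residue because
  \<open>d\<close> is at least 2.\<close>

lemma weyl_op_noncommute:
  assumes "length x = length z" "set x \<subseteq> {..<d}" "set z \<subseteq> {..<d}" "d \<ge> 2"
    and "weyl_op d x z \<noteq> 1\<^sub>m (d ^ length x)"
  shows "\<exists>x' z' c. length x' = length x \<and> length z' = length x \<and> set x' \<subseteq> {..<d} \<and> set z' \<subseteq> {..<d} \<and>
    cmod c = 1 \<and> c \<noteq> 1 \<and> commute_up_to c (weyl_op d x' z') (weyl_op d x z)"
  using assms(1-3,5)
proof (induction rule: list_induct2)
  case Nil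
  then show ?case by simp
next
  case (Cons a x b z)
  let ?A = "shift_op d ^\<^sub>m a * clock_op d ^\<^sub>m b" and ?w = "root_of_unity d" and ?o = "replicate (length x) (0::nat)"
  have d: "d > 0" using assms(4) by simp
  have ab: "a < d" "b < d" using Cons.prems by auto
  have A: "?A \<in> carrier_mat d d" by auto
  have W: "weyl_op d x z \<in> carrier_mat (d ^ length x) (d ^ length x)"
    by (rule unitary_op_carrier[OF unitary_op_weyl[OF Cons.hyps d]])
  have one: "commute_up_to 1 (weyl_op d ?o ?o) (weyl_op d x z)"
    using W by (simp add: weyl_op_zero commute_up_to_one_left)
  have o: "set ?o \<subseteq> {..<d}" using d by auto
  have Z1: "weyl_op d (0 # ?o) (1 # ?o) = kron (clock_op d) (weyl_op d ?o ?o)"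
    and X1: "weyl_op d (1 # ?o) (0 # ?o) = kron (shift_op d) (weyl_op d ?o ?o)"
    by (simp_all add: weyl_op_Cons carrier_matD[OF shift_op_carrier] carrier_matD[OF clock_op_carrier]
        left_mult_one_mat[of _ d d] right_mult_one_mat[of _ d d])
  show ?case
  proof (cases "a = 0 \<and> b = 0")
    case False
    show ?thesis
    proof (cases "a = 0")
      case False
      have "commute_up_to (?w ^ a * 1) (weyl_op d (0 # ?o) (1 # ?o)) (weyl_op d (a # x) (b # z))"
        unfolding Z1 weyl_op_Cons[OF Cons.hyps]
        using A W one commute_up_to_clock_weyl[OF d]
        by (intro commute_up_to_kron[where m = d and n = "d ^ length x"]) (auto simp: weyl_op_zero)
      moreover have "?w ^ a * 1 \<noteq> 1" "cmod (?w ^ a * 1) = 1"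
        using False ab by (auto simp: root_of_unity_pow_eq_1_iff norm_power)
      ultimately show ?thesis
        using o assms(4)
        by (intro exI[of _ "0 # ?o"] exI[of _ "1 # ?o"] exI[of _ "?w ^ a * 1"]) auto
    next
      case True
      with False have "b \<noteq> 0" by simp
      have "commute_up_to (cnj (?w ^ b) * 1) (weyl_op d (1 # ?o) (0 # ?o)) (weyl_op d (a # x) (b # z))"
        unfolding X1 weyl_op_Cons[OF Cons.hyps]
        using A W one commute_up_to_shift_weyl[OF d]
        by (intro commute_up_to_kron[where m = d and n = "d ^ length x"]) (auto simp: weyl_op_zero)
      moreover have "cnj (?w ^ b) * 1 \<noteq> 1" "cmod (cnj (?w ^ b) * 1) = 1"
        using \<open>b \<noteq> 0\<close> ab root_of_unity_pow_eq_1_iff[of b d] by (auto simp: norm_power simp flip: complex_cnj_power)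
      ultimately show ?thesis
        using o assms(4)
        by (intro exI[of _ "1 # ?o"] exI[of _ "0 # ?o"] exI[of _ "cnj (?w ^ b) * 1"]) auto
    qed
  next
    case True
    then have eq: "weyl_op d (a # x) (b # z) = kron (1\<^sub>m d) (weyl_op d x z)"
      using weyl_op_Cons[OF Cons.hyps, of d 0 0]
      by (simp add: carrier_matD[OF shift_op_carrier] carrier_matD[OF clock_op_carrier])
    \<comment> \<open>The head is the identity here, so an identity tail would make the whole
      operator the identity. The witness for the tail is then padded with a trivial first
      factor.\<close>
    have "weyl_op d x z \<noteq> 1\<^sub>m (d ^ length x)"
      using Cons.prems(3) eq by (auto simp: kron_one)
    with Cons obtain x' z' c where IH: "length x' = length x" "length z' = length x"
      "set x' \<subseteq> {..<d}" "set z' \<subseteq> {..<d}" "cmod c = 1" "c \<noteq> 1"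
      "commute_up_to c (weyl_op d x' z') (weyl_op d x z)" by auto
    have eq': "weyl_op d (0 # x') (0 # z') = kron (1\<^sub>m d) (weyl_op d x' z')"
      using IH weyl_op_Cons[of x' z' d 0 0]
      by (simp add: carrier_matD[OF shift_op_carrier] carrier_matD[OF clock_op_carrier])
    have "weyl_op d x' z' \<in> carrier_mat (d ^ length x) (d ^ length x)"
      using unitary_op_carrier[OF unitary_op_weyl[OF _ d, of x' z']] IH by simp
    then have "commute_up_to (1 * c) (weyl_op d (0 # x') (0 # z')) (weyl_op d (a # x) (b # z))"
      unfolding eq eq' using W IH
      by (intro commute_up_to_kron[where m = d and n = "d ^ length x"] commute_up_to_self) auto
    then show ?thesis
      using IH d by (intro exI[of _ "0 # x'"] exI[of _ "0 # z'"] exI[of _ c]) auto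
  qed
qed

section \<open>The set \<open>PW\<close> of Weyl operators\<close>

lemma unitary_op_PW:
  assumes "d > 0" "W \<in> PW d n"
  shows "unitary_op (d ^ n) W"
proof -
  obtain x z where "W = weyl_op d x z" "length x = n" "length z = n"
    using assms(2) by (auto simp: PW_def Zd_vecs_def)
  then show ?thesis using unitary_op_weyl[of x z d] assms(1) by simp
qed

lemma PW_commute:
  assumes "d > 0" "W \<in> PW d n" "W' \<in> PW d n"
  shows "\<exists>c. cmod c = 1 \<and> commute_up_to c W W'"
  using assms weyl_op_commute by (fastforce simp: PW_def Zd_vecs_def)

lemma PW_noncommute:
  assumes "d \<ge> 2" "W \<in> PW d n" "W \<noteq> 1\<^sub>m (d ^ n)"
  shows "\<exists>W'\<in>PW d n. \<exists>c. cmod c = 1 \<and> c \<noteq> 1 \<and> commute_up_to c W' W"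
proof -
  obtain x z where W: "W = weyl_op d x z" "x \<in> Zd_vecs d n" "z \<in> Zd_vecs d n"
    using assms(2) by (auto simp: PW_def)
  then obtain x' z' c where "length x' = n" "length z' = n" "set x' \<subseteq> {..<d}" "set z' \<subseteq> {..<d}"
    "cmod c = 1" "c \<noteq> 1" "commute_up_to c (weyl_op d x' z') (weyl_op d x z)"
    using weyl_op_noncommute[of x z d] assms by (auto simp: Zd_vecs_def)
  then show ?thesis using W(1) by (auto simp: PW_def Zd_vecs_def)
qed

lemma finite_PW: "finite (PW d n)"
proof -
  have "finite (Zd_vecs d n)"
    using finite_lists_length_eq[of "{..<d}" n] by (simp add: Zd_vecs_def conj_commute)
  moreover have "PW d n = (\<lambda>(x, z). weyl_op d x z) ` (Zd_vecs d n \<times> Zd_vecs d n)"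
    by (auto simp: PW_def)
  ultimately show ?thesis by simp
qed

subsection \<open>Stabilizers and cospaces\<close>

text \<open>The choice turns the phase into a function that can be summed. For a Weyl operator and a
  stabilizer such a phase exists by \<open>PW_SS_commute\<close> and is unique by
  \<open>phase_eqI\<close>.\<close>

definition commutation_phase :: "complex mat \<Rightarrow> complex mat \<Rightarrow> complex" where
  "commutation_phase A B = (SOME c. cmod c = 1 \<and> commute_up_to c A B)"

locale stabilizer_code =
  fixes d n k :: nat and SS :: "complex mat set"
  assumes d_ge_2: "d \<ge> 2" and stab: "stabilizer_group d n k SS"
begin

abbreviation "N \<equiv> d ^ n"
abbreviation "\<chi> \<equiv> commutation_phase"

lemma d_pos: "d > 0" and N_pos: "N > 0"
  using d_ge_2 by auto

lemma card_SS_pos: "card SS > 0"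
  using stab d_pos by (simp add: stabilizer_group_def)

text \<open>An infinite set has \<open>card\<close> equal to 0, so the prescribed positive order
  forces finiteness.\<close>

lemma finite_SS: "finite SS"
  using card_SS_pos card_ge_0_finite by blast

lemma group_SS: "group (op_ring d n\<lparr>carrier := SS\<rparr>)"
  using stab by (simp add: stabilizer_group_def comm_group_def)

text \<open>Replacing the carrier keeps the unit of \<open>op_ring\<close>, so the neutral element
  of the group is the identity matrix itself.\<close>

lemma one_in_SS: "1\<^sub>m N \<in> SS"
  using monoid.one_closed[OF group.is_monoid[OF group_SS]] by (simp add: ring_mat_simps)

lemma mult_in_SS: "S \<in> SS \<Longrightarrow> S' \<in> SS \<Longrightarrow> S * S' \<in> SS"
  using monoid.m_closed[OF group.is_monoid[OF group_SS]]
  by (auto simp: ring_mat_simps)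

lemma SS_phase_PW:
  assumes "S \<in> SS"
  obtains c M where "S = c \<cdot>\<^sub>m M" "cmod c = 1" "M \<in> PW d n"
  using stab assms by (auto simp: stabilizer_group_def phase_multiples_def)

lemma unitary_op_SS: "S \<in> SS \<Longrightarrow> unitary_op N S"
  by (metis SS_phase_PW unitary_op_smult unitary_op_PW d_pos)

lemma SS_carrier: "S \<in> SS \<Longrightarrow> S \<in> carrier_mat N N"
  by (rule unitary_op_carrier[OF unitary_op_SS])

lemma PW_carrier: "W \<in> PW d n \<Longrightarrow> W \<in> carrier_mat N N"
  by (rule unitary_op_carrier[OF unitary_op_PW[OF d_pos]])

text \<open>The group inverse of \<open>S\<close> is its adjoint: multiply \<open>S * S' = 1\<close>
  from the left by the adjoint and use unitarity.\<close>

lemma adjoint_in_SS: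
  assumes "S \<in> SS"
  shows "mat_adjoint S \<in> SS"
proof -
  obtain S' where S': "S' \<in> SS" "S * S' = 1\<^sub>m N"
    using group.r_inv_ex[OF group_SS, of S] assms
    by (auto simp: ring_mat_simps)
  have c: "S \<in> carrier_mat N N" "S' \<in> carrier_mat N N" "mat_adjoint S \<in> carrier_mat N N"
    using SS_carrier assms S' by auto
  have "mat_adjoint S = mat_adjoint S * (S * S')" using S' c by simp
  also have "\<dots> = (mat_adjoint S * S) * S'" using c by (simp add: square_mat_simps[where N = N])
  also have "\<dots> = S'" using unitary_op_SS[OF assms] c by (simp add: unitary_op_def)
  finally show ?thesis using S' by simp
qed

text \<open>The adjoint cancels \<open>S\<close>, and an injective self-map of a finite set is onto.
  This allows translating the index of sums over the group.\<close>

lemma bij_betw_mult_SS: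
  assumes "S \<in> SS"
  shows "bij_betw ((*) S) SS SS"
proof -
  have "mat_adjoint S * (S * S') = S'" if "S' \<in> SS" for S'
  proof -
    have c: "S \<in> carrier_mat N N" "S' \<in> carrier_mat N N" "mat_adjoint S \<in> carrier_mat N N"
      using SS_carrier assms that by auto
    then have "mat_adjoint S * (S * S') = (mat_adjoint S * S) * S'"
      by (simp add: square_mat_simps[where N = N])
    also have "\<dots> = S'" using unitary_op_SS[OF assms] c by (simp add: unitary_op_def)
    finally show ?thesis .
  qed
  then have "inj_on ((*) S) SS" by (metis inj_onI)
  moreover have "(*) S ` SS \<subseteq> SS" using assms mult_in_SS by auto
  ultimately show ?thesis using finite_SS by (simp add: bij_betw_def endo_inj_surj)
qed

section \<open>Commutation phases as characters of the stabilizer group\<close>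

lemma PW_SS_commute:
  assumes "W \<in> PW d n" "S \<in> SS"
  shows "\<exists>c. cmod c = 1 \<and> commute_up_to c W S"
proof -
  obtain a M where M: "S = a \<cdot>\<^sub>m M" "M \<in> PW d n" using SS_phase_PW assms by metis
  obtain c where "cmod c = 1" "commute_up_to c W M"
    using PW_commute[OF d_pos assms(1) M(2)] by blast
  then show ?thesis
    unfolding M(1) using commute_up_to_smult_right PW_carrier assms(1) M(2) by blast
qed

lemma norm_phase: "W \<in> PW d n \<Longrightarrow> S \<in> SS \<Longrightarrow> cmod (\<chi> W S) = 1"
  and commute_up_to_phase: "W \<in> PW d n \<Longrightarrow> S \<in> SS \<Longrightarrow> commute_up_to (\<chi> W S) W S"
  using someI_ex[OF PW_SS_commute] by (auto simp: commutation_phase_def)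

lemma phase_eqI:
  assumes "W \<in> PW d n" "S \<in> SS" "commute_up_to c W S"
  shows "\<chi> W S = c"
  by (rule commute_up_to_unique[of N W S]) (use assms in \<open>simp_all add: unitary_op_PW d_pos
      unitary_op_SS commute_up_to_phase\<close>)

lemma phase_mult:
  assumes "W \<in> PW d n" "S \<in> SS" "S' \<in> SS"
  shows "\<chi> W (S * S') = \<chi> W S * \<chi> W S'"
  using assms by (intro phase_eqI mult_in_SS commute_up_to_mult_right[where N = N]
      PW_carrier SS_carrier commute_up_to_phase)

lemma phase_one: "W \<in> PW d n \<Longrightarrow> \<chi> W (1\<^sub>m N) = 1"
  by (intro phase_eqI one_in_SS commute_up_to_one_right PW_carrier)

lemma phase_adjoint:
  assumes "W \<in> PW d n" "S \<in> SS"
  shows "\<chi> W (mat_adjoint S) = cnj (\<chi> W S)"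
proof -
  have "\<chi> W S * \<chi> W (mat_adjoint S) = 1"
    using phase_mult[OF assms adjoint_in_SS[OF assms(2)]] unitary_op_SS[OF assms(2)] phase_one assms(1)
    by (simp add: unitary_op_def)
  then have "cnj (\<chi> W S) * (\<chi> W S * \<chi> W (mat_adjoint S)) = cnj (\<chi> W S)" by simp
  then show ?thesis
    by (simp add: mult.assoc[symmetric] cmod_one_cnj_mult norm_phase[OF assms])
qed

text \<open>Strip the phase \<open>a\<close> off \<open>S\<close>. The remaining Weyl operator is
  not the identity, since otherwise \<open>S\<close> would be a phase multiple of the identity and
  the stabilizer condition would give \<open>a = 1\<close>. Nondegeneracy then supplies
  \<open>W\<close>.\<close>

lemma phase_separates:
  assumes "S \<in> SS" "S \<noteq> 1\<^sub>m N"
  shows "\<exists>W\<in>PW d n. \<chi> W S \<noteq> 1"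
proof -
  obtain a M where M: "S = a \<cdot>\<^sub>m M" "cmod a = 1" "M \<in> PW d n" using SS_phase_PW assms by metis
  have "M \<noteq> 1\<^sub>m N"
  proof
    assume "M = 1\<^sub>m N"
    moreover have "a = 1" using stab assms(1) M \<open>M = 1\<^sub>m N\<close> by (auto simp: stabilizer_group_def)
    ultimately show False using assms(2) M(1) by simp
  qed
  then obtain W c where W: "W \<in> PW d n" "c \<noteq> 1" "commute_up_to c W M"
    using PW_noncommute[OF d_ge_2 M(3)] by blast
  then have "commute_up_to c W S"
    unfolding M(1) using commute_up_to_smult_right PW_carrier M(3) by blast
  then have "\<chi> W S = c" using phase_eqI W(1) assms(1) by blast
  with W show ?thesis by blast
qed

section \<open>Traces of stabilizers and images of the codespace\<close>

lemma conj_PW_SS: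
  assumes "W \<in> PW d n" "S \<in> SS"
  shows "W * S * mat_adjoint W = \<chi> W S \<cdot>\<^sub>m S"
proof -
  have c: "W \<in> carrier_mat N N" "S \<in> carrier_mat N N" "mat_adjoint W \<in> carrier_mat N N"
    using PW_carrier SS_carrier assms by auto
  have "W * S * mat_adjoint W = \<chi> W S \<cdot>\<^sub>m (S * (W * mat_adjoint W))"
    using commute_up_to_phase[OF assms] c
    by (simp add: commute_up_to_def square_mat_simps[where N = N])
  also have "\<dots> = \<chi> W S \<cdot>\<^sub>m S"
    using unitary_op_PW[OF d_pos assms(1)] c by (simp add: unitary_op_def)
  finally show ?thesis .
qed

text \<open>Conjugation by a suitable Weyl operator preserves the trace but multiplies
  \<open>S\<close> by a phase other than 1.\<close>

lemma trace_SS: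
  assumes "S \<in> SS" "S \<noteq> 1\<^sub>m N"
  shows "(\<Sum>i = 0..<N. S $$ (i, i)) = 0"
proof -
  obtain W where W: "W \<in> PW d n" "\<chi> W S \<noteq> 1" using phase_separates[OF assms] by blast
  have c: "W \<in> carrier_mat N N" "S \<in> carrier_mat N N" "mat_adjoint W \<in> carrier_mat N N"
    "W * S \<in> carrier_mat N N"
    using PW_carrier SS_carrier assms W by (auto intro: mult_carrier_mat)
  have "\<chi> W S * (\<Sum>i = 0..<N. S $$ (i, i)) = (\<Sum>i = 0..<N. (W * S * mat_adjoint W) $$ (i, i))"
    using c by (simp add: conj_PW_SS[OF W(1) assms(1)] sum_distrib_left carrier_matD)
  also have "\<dots> = (\<Sum>i = 0..<N. \<Sum>j = 0..<N. (W * S) $$ (i, j) * mat_adjoint W $$ (j, i))"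
    using c by (intro sum.cong mult_mat_index_sum) auto
  also have "\<dots> = (\<Sum>j = 0..<N. \<Sum>i = 0..<N. mat_adjoint W $$ (j, i) * (W * S) $$ (i, j))"
    by (subst sum.swap) (simp only: mult.commute)
  also have "\<dots> = (\<Sum>j = 0..<N. (mat_adjoint W * (W * S)) $$ (j, j))"
    using c by (intro sum.cong mult_mat_index_sum[symmetric]) auto
  also have "mat_adjoint W * (W * S) = (mat_adjoint W * W) * S"
    using c by (simp add: square_mat_simps[where N = N])
  also have "\<dots> = S"
    using unitary_op_PW[OF d_pos W(1)] c by (simp add: unitary_op_def)
  finally show ?thesis using W(2) by simp
qed

text \<open>Every column of the sum \<open>P\<close> of all stabilizers lies in the codespace,
  because left multiplication by a stabilizer only permutes the summands. Only the identity
  contributes to the trace of \<open>P\<close>, which is thus \<open>N\<close>, so some column is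
  nonzero.\<close>

lemma codespace_nonzero: "\<exists>v\<in>codespace d n SS. v \<noteq> 0\<^sub>v N"
proof -
  define P where "P = (\<Oplus>\<^bsub>op_ring d n\<^esub>S\<in>SS. S)"
  have P: "P \<in> carrier_mat N N"
    unfolding P_def by (intro finsum_ring_mat_carrier finite_SS SS_carrier)
  have P_index: "P $$ (i, j) = (\<Sum>S\<in>SS. S $$ (i, j))" if "i < N" "j < N" for i j
    unfolding P_def using that by (intro finsum_ring_mat_index finite_SS SS_carrier)
  have fixed: "S * P = P" if S: "S \<in> SS" for S
  proof (rule eq_matI)
    fix i j assume "i < dim_row P" "j < dim_col P"
    then have ij: "i < N" "j < N" using P by auto
    have "(S * P) $$ (i, j) = (\<Sum>S'\<in>SS. (S * S') $$ (i, j))"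
      unfolding P_def using ij S by (intro mult_finsum_index finite_SS SS_carrier)
    also have "\<dots> = (\<Sum>S'\<in>SS. S' $$ (i, j))"
      by (rule sum.reindex_bij_betw[OF bij_betw_mult_SS[OF S]])
    finally show "(S * P) $$ (i, j) = P $$ (i, j)" using P_index ij by simp
  qed (use P SS_carrier[OF S] in auto)
  have "(\<Sum>i = 0..<N. P $$ (i, i)) = (\<Sum>S\<in>SS. \<Sum>i = 0..<N. S $$ (i, i))"
    by (subst sum.swap) (simp add: P_index)
  also have "\<dots> = (\<Sum>S\<in>SS. if S = 1\<^sub>m N then of_nat N else 0)"
    by (intro sum.cong refl) (auto simp: trace_SS)
  also have "\<dots> = of_nat N"
    using finite_SS one_in_SS by simp
  also have "\<dots> \<noteq> 0" using N_pos by simp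
  finally obtain i where i: "i < N" "P $$ (i, i) \<noteq> 0"
    by (metis (no_types, lifting) atLeastLessThan_iff sum.neutral)
  have "col P i $ i \<noteq> 0\<^sub>v N $ i" using i P by (simp add: carrier_matD)
  moreover have "col P i \<in> codespace d n SS"
    using P i fixed col_mult2[OF SS_carrier P i(1)]
    by (auto simp: codespace_def joint_eigenspace_def)
  ultimately show ?thesis by metis
qed

text \<open>Moving \<open>S\<close> past \<open>W\<close> costs the conjugate phase, and
  \<open>S\<close> fixes code vectors. Conversely, the adjoint of \<open>W\<close> brings an
  eigenvector with these eigenvalues back into the codespace.\<close>

lemma image_codespace:
  assumes "W \<in> PW d n"
  shows "(\<lambda>v. W *\<^sub>v v) ` codespace d n SS = joint_eigenspace d n SS (\<lambda>S. cnj (\<chi> W S))"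
proof -
  have W: "W \<in> carrier_mat N N" "mat_adjoint W \<in> carrier_mat N N"
    using PW_carrier assms by auto
  have WW: "W * mat_adjoint W = 1\<^sub>m N"
    using unitary_op_PW[OF d_pos assms] by (simp add: unitary_op_def)
  have WS: "W * S = \<chi> W S \<cdot>\<^sub>m (S * W)" and SW: "S * W = cnj (\<chi> W S) \<cdot>\<^sub>m (W * S)" if "S \<in> SS" for S
    using commute_up_to_phase[OF assms that]
      commute_up_to_sym[OF norm_phase[OF assms that] commute_up_to_phase[OF assms that]]
    by (auto simp: commute_up_to_def)
  show ?thesis
  proof (intro equalityI subsetI)
    fix w assume "w \<in> (\<lambda>v. W *\<^sub>v v) ` codespace d n SS"
    then obtain v where v: "w = W *\<^sub>v v" "v \<in> carrier_vec N" "\<And>S. S \<in> SS \<Longrightarrow> S *\<^sub>v v = v"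
      by (auto simp: codespace_def joint_eigenspace_def)
    have "S *\<^sub>v w = cnj (\<chi> W S) \<cdot>\<^sub>v w" if S: "S \<in> SS" for S
    proof -
      have c: "S \<in> carrier_mat N N" "W * S \<in> carrier_mat N N" using SS_carrier S W by auto
      have "S *\<^sub>v w = (S * W) *\<^sub>v v"
        using v W c by (simp add: assoc_mult_mat_vec[of S N N W N])
      also have "\<dots> = cnj (\<chi> W S) \<cdot>\<^sub>v ((W * S) *\<^sub>v v)"
        unfolding SW[OF S] using c v by (intro smult_mult_mat_vec)
      also have "(W * S) *\<^sub>v v = w"
        using v W c S by (simp add: assoc_mult_mat_vec[of W N N S N])
      finally show ?thesis .
    qed
    then show "w \<in> joint_eigenspace d n SS (\<lambda>S. cnj (\<chi> W S))"
      using v W by (auto simp: joint_eigenspace_def)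
  next
    fix w assume "w \<in> joint_eigenspace d n SS (\<lambda>S. cnj (\<chi> W S))"
    then have w: "w \<in> carrier_vec N" "\<And>S. S \<in> SS \<Longrightarrow> S *\<^sub>v w = cnj (\<chi> W S) \<cdot>\<^sub>v w"
      by (auto simp: joint_eigenspace_def)
    let ?v = "mat_adjoint W *\<^sub>v w"
    have v: "?v \<in> carrier_vec N" using W(2) w(1) by (rule mult_mat_vec_carrier)
    have Wv: "W *\<^sub>v ?v = w"
      using W w WW by (simp flip: assoc_mult_mat_vec[of W N N "mat_adjoint W" N])
    have "S *\<^sub>v ?v = ?v" if S: "S \<in> SS" for S
    proof -
      have c: "S \<in> carrier_mat N N" using SS_carrier S by auto
      \<comment> \<open>The equation is first established after applying \<open>W\<close>, which its
        adjoint then cancels.\<close>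
      have "W *\<^sub>v (S *\<^sub>v ?v) = (W * S) *\<^sub>v ?v"
        using W c v by (simp add: assoc_mult_mat_vec[of W N N S N])
      also have "\<dots> = \<chi> W S \<cdot>\<^sub>v ((S * W) *\<^sub>v ?v)"
        unfolding WS[OF S] using c v W
        by (intro smult_mult_mat_vec[where m = N and n = N]) (auto intro: mult_carrier_mat)
      also have "(S * W) *\<^sub>v ?v = S *\<^sub>v (W *\<^sub>v ?v)"
        using W c v by (simp add: assoc_mult_mat_vec[of S N N W N])
      also have "\<chi> W S \<cdot>\<^sub>v (S *\<^sub>v (W *\<^sub>v ?v)) = w"
        unfolding Wv using w S norm_phase[OF assms S] by (simp add: smult_smult_assoc cmod_one_cnj_mult)
      finally have "mat_adjoint W *\<^sub>v (W *\<^sub>v (S *\<^sub>v ?v)) = ?v" by simp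
      moreover have "mat_adjoint W *\<^sub>v (W *\<^sub>v u) = u" if "u \<in> carrier_vec N" for u
        using W that unitary_op_PW[OF d_pos assms]
        by (simp add: unitary_op_def flip: assoc_mult_mat_vec[of "mat_adjoint W" N N W N])
      ultimately show ?thesis using c v by simp
    qed
    then have "?v \<in> codespace d n SS" using v by (simp add: codespace_def joint_eigenspace_def)
    then show "w \<in> (\<lambda>v. W *\<^sub>v v) ` codespace d n SS" using Wv by (metis image_eqI)
  qed
qed

lemma image_codespace_nonzero:
  assumes "W \<in> PW d n"
  shows "\<exists>v\<in>(\<lambda>v. W *\<^sub>v v) ` codespace d n SS. v \<noteq> 0\<^sub>v N"
proof -
  obtain v where v: "v \<in> codespace d n SS" "v \<noteq> 0\<^sub>v N" using codespace_nonzero by blast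
  have W: "W \<in> carrier_mat N N" "mat_adjoint W \<in> carrier_mat N N"
    using PW_carrier assms by auto
  have vc: "v \<in> carrier_vec N" using v by (simp add: codespace_def joint_eigenspace_def)
  have "mat_adjoint W *\<^sub>v (W *\<^sub>v v) = v"
    using W vc unitary_op_PW[OF d_pos assms]
    by (simp add: unitary_op_def flip: assoc_mult_mat_vec[of "mat_adjoint W" N N W N])
  moreover have "mat_adjoint W *\<^sub>v 0\<^sub>v N = 0\<^sub>v N"
    using W by (intro eq_vecI) (auto simp: carrier_matD)
  ultimately have "W *\<^sub>v v \<noteq> 0\<^sub>v N" using v by metis
  then show ?thesis using v by blast
qed

text \<open>\<open>cospaces\<close> leaves out the zero space, so this rests on the codespace being
  nonzero.\<close>

lemma image_codespace_in_cospaces: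
  "W \<in> PW d n \<Longrightarrow> (\<lambda>v. W *\<^sub>v v) ` codespace d n SS \<in> cospaces d n SS"
  using image_codespace image_codespace_nonzero unfolding cospaces_def by blast

text \<open>A nonzero vector of the common image has only one eigenvalue under
  \<open>S\<close>.\<close>

lemma phase_eq_if_image_eq:
  assumes "W \<in> PW d n" "W' \<in> PW d n" "S \<in> SS"
    and eq: "(\<lambda>v. W *\<^sub>v v) ` codespace d n SS = (\<lambda>v. W' *\<^sub>v v) ` codespace d n SS"
  shows "\<chi> W S = \<chi> W' S"
proof -
  obtain v where v: "v \<in> (\<lambda>v. W *\<^sub>v v) ` codespace d n SS" "v \<noteq> 0\<^sub>v N"
    using image_codespace_nonzero assms(1) by blast
  have vc: "v \<in> carrier_vec N"
    and "S *\<^sub>v v = cnj (\<chi> W S) \<cdot>\<^sub>v v"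
    and "S *\<^sub>v v = cnj (\<chi> W' S) \<cdot>\<^sub>v v"
    using v(1) v(1)[unfolded eq] assms(1-3)
    unfolding image_codespace[OF assms(1)] image_codespace[OF assms(2)]
    by (simp_all add: joint_eigenspace_def)
  then have e: "cnj (\<chi> W S) \<cdot>\<^sub>v v = cnj (\<chi> W' S) \<cdot>\<^sub>v v" by simp
  obtain i where i: "i < N" "v $ i \<noteq> 0" using v(2) vc by (metis carrier_vecD eq_vecI index_zero_vec)
  have "cnj (\<chi> W S) * v $ i = cnj (\<chi> W' S) * v $ i"
    using arg_cong[OF e, of "\<lambda>u. u $ i"] i vc by simp
  then show ?thesis using i by simp
qed

lemma image_eq_if_phase_eq:
  assumes "W \<in> PW d n" "W' \<in> PW d n" "\<And>S. S \<in> SS \<Longrightarrow> \<chi> W S = \<chi> W' S"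
  shows "(\<lambda>v. W *\<^sub>v v) ` codespace d n SS = (\<lambda>v. W' *\<^sub>v v) ` codespace d n SS"
  using assms by (auto simp: image_codespace joint_eigenspace_def)

lemma one_in_PW: "1\<^sub>m N \<in> PW d n"
proof -
  have "replicate n 0 \<in> Zd_vecs d n" using d_pos by (auto simp: Zd_vecs_def)
  then show ?thesis unfolding PW_def using weyl_op_zero[of d n] by force
qed

text \<open>Translating the summation index by \<open>S\<close> multiplies the sum by
  \<open>\<chi> W S\<close>, which differs from 1.\<close>

lemma sum_SS_phase:
  assumes "W \<in> PW d n" "S \<in> SS" "\<chi> W S \<noteq> 1"
  shows "(\<Sum>S'\<in>SS. \<chi> W S') = 0"
proof -
  have "(\<Sum>S'\<in>SS. \<chi> W S') = (\<Sum>S'\<in>SS. \<chi> W (S * S'))"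
    by (rule sum.reindex_bij_betw[OF bij_betw_mult_SS[OF assms(2)], symmetric])
  also have "\<dots> = \<chi> W S * (\<Sum>S'\<in>SS. \<chi> W S')"
    using assms by (simp add: phase_mult sum_distrib_left)
  finally show ?thesis using assms(3) by simp
qed

section \<open>Entries and adjoints of the projectors\<close>

lemma code_proj_carrier: "code_proj d n SS \<in> carrier_mat N N"
  and code_proj_index: "i < N \<Longrightarrow> j < N \<Longrightarrow>
    code_proj d n SS $$ (i, j) = (1 / of_nat (card SS)) * (\<Sum>S\<in>SS. S $$ (i, j))"
proof -
  have "(\<Oplus>\<^bsub>op_ring d n\<^esub>S\<in>SS. S) \<in> carrier_mat N N"
    by (intro finsum_ring_mat_carrier finite_SS SS_carrier)
  then show "code_proj d n SS \<in> carrier_mat N N"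
    "i < N \<Longrightarrow> j < N \<Longrightarrow>
      code_proj d n SS $$ (i, j) = (1 / of_nat (card SS)) * (\<Sum>S\<in>SS. S $$ (i, j))"
    using finsum_ring_mat_index[where f = "\<lambda>S. S" and N = N and b = "()", OF finite_SS SS_carrier]
    by (auto simp: code_proj_def carrier_matD)
qed

text \<open>Taking adjoints permutes the stabilizer group.\<close>

lemma code_proj_adjoint: "mat_adjoint (code_proj d n SS) = code_proj d n SS"
proof (rule eq_matI)
  fix i j assume "i < dim_row (code_proj d n SS)" "j < dim_col (code_proj d n SS)"
  then have ij: "i < N" "j < N" using code_proj_carrier by auto
  have bij: "bij_betw mat_adjoint SS SS"
    by (rule bij_betw_byWitness[where f' = mat_adjoint]) (auto intro: adjoint_in_SS)
  have "(\<Sum>S\<in>SS. cnj (S $$ (j, i))) = (\<Sum>S\<in>SS. mat_adjoint S $$ (i, j))"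
    using ij by (intro sum.cong refl mat_adjoint_index[symmetric]) (auto simp: carrier_matD[OF SS_carrier])
  also have "\<dots> = (\<Sum>S\<in>SS. S $$ (i, j))"
    by (rule sum.reindex_bij_betw[OF bij])
  finally show "mat_adjoint (code_proj d n SS) $$ (i, j) = code_proj d n SS $$ (i, j)"
    using ij code_proj_carrier by (simp add: code_proj_index carrier_matD)
qed (use code_proj_carrier in auto)

lemma cospace_proj_carrier: "W \<in> PW d n \<Longrightarrow> cospace_proj d n SS W \<in> carrier_mat N N"
  unfolding cospace_proj_def
  by (intro mult_carrier_mat[of _ N N] PW_carrier code_proj_carrier mat_adjoint_carrier)

lemma cospace_proj_adjoint:
  assumes "W \<in> PW d n"
  shows "mat_adjoint (cospace_proj d n SS W) = cospace_proj d n SS W"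
proof -
  have W: "W \<in> carrier_mat N N" "mat_adjoint W \<in> carrier_mat N N"
    using PW_carrier assms by auto
  then have "dim_col (W * code_proj d n SS) = dim_row (mat_adjoint W)"
    "dim_col W = dim_row (code_proj d n SS)"
    using code_proj_carrier by (auto simp: carrier_matD)
  then have "mat_adjoint (cospace_proj d n SS W) = W * (code_proj d n SS * mat_adjoint W)"
    by (simp add: cospace_proj_def mat_adjoint_mult code_proj_adjoint)
  also have "\<dots> = cospace_proj d n SS W"
    unfolding cospace_proj_def
    by (rule assoc_mult_mat[symmetric, OF W(1) code_proj_carrier W(2)])
  finally show ?thesis .
qed

text \<open>Conjugating the group average by \<open>W\<close> weights each \<open>S\<close> with
  \<open>\<chi> W S\<close>, so the projector is a Fourier sum over the stabilizer group.\<close>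

lemma cospace_proj_index:
  assumes "W \<in> PW d n" "i < N" "j < N"
  shows "cospace_proj d n SS W $$ (i, j) = (1 / of_nat (card SS)) * (\<Sum>S\<in>SS. \<chi> W S * S $$ (i, j))"
proof -
  have W: "W \<in> carrier_mat N N" "mat_adjoint W \<in> carrier_mat N N"
    using PW_carrier assms by auto
  have "cospace_proj d n SS W $$ (i, j) =
      (\<Sum>k = 0..<N. (W * code_proj d n SS) $$ (i, k) * mat_adjoint W $$ (k, j))"
    unfolding cospace_proj_def using W assms code_proj_carrier
    by (intro mult_mat_index_sum mult_carrier_mat[of _ N N]) auto
  also have "\<dots> = (\<Sum>k = 0..<N. (1 / of_nat (card SS)) * (\<Sum>S\<in>SS. (W * S) $$ (i, k)) * mat_adjoint W $$ (k, j))"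
  proof (intro sum.cong refl)
    fix k assume "k \<in> {0..<N}"
    then have k: "k < N" by simp
    have "(W * code_proj d n SS) $$ (i, k) = (\<Sum>l = 0..<N. W $$ (i, l) * code_proj d n SS $$ (l, k))"
      using W assms k code_proj_carrier by (intro mult_mat_index_sum)
    also have "\<dots> = (\<Sum>l = 0..<N. \<Sum>S\<in>SS. (1 / of_nat (card SS)) * (W $$ (i, l) * S $$ (l, k)))"
      using k by (simp add: code_proj_index sum_distrib_left mult.left_commute)
    also have "\<dots> = (1 / of_nat (card SS)) * (\<Sum>S\<in>SS. \<Sum>l = 0..<N. W $$ (i, l) * S $$ (l, k))"
      by (subst sum.swap) (simp add: sum_distrib_left)
    also have "(\<Sum>S\<in>SS. \<Sum>l = 0..<N. W $$ (i, l) * S $$ (l, k)) = (\<Sum>S\<in>SS. (W * S) $$ (i, k))"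
      using W assms k SS_carrier by (intro sum.cong refl mult_mat_index_sum[symmetric])
    finally show "(W * code_proj d n SS) $$ (i, k) * mat_adjoint W $$ (k, j) =
      (1 / of_nat (card SS)) * (\<Sum>S\<in>SS. (W * S) $$ (i, k)) * mat_adjoint W $$ (k, j)" by simp
  qed
  also have "\<dots> = (\<Sum>k = 0..<N. \<Sum>S\<in>SS. (1 / of_nat (card SS)) * ((W * S) $$ (i, k) * mat_adjoint W $$ (k, j)))"
    by (simp only: sum_distrib_left sum_distrib_right mult.assoc)
  also have "\<dots> = (1 / of_nat (card SS)) *
      (\<Sum>S\<in>SS. \<Sum>k = 0..<N. (W * S) $$ (i, k) * mat_adjoint W $$ (k, j))"
    by (subst sum.swap) (simp only: sum_distrib_left)
  also have "(\<Sum>S\<in>SS. \<Sum>k = 0..<N. (W * S) $$ (i, k) * mat_adjoint W $$ (k, j)) =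
      (\<Sum>S\<in>SS. (W * S * mat_adjoint W) $$ (i, j))"
    using W assms SS_carrier
    by (intro sum.cong refl mult_mat_index_sum[symmetric] mult_carrier_mat[of _ N N]) auto
  also have "\<dots> = (\<Sum>S\<in>SS. \<chi> W S * S $$ (i, j))"
  proof (intro sum.cong refl)
    fix S assume S: "S \<in> SS"
    show "(W * S * mat_adjoint W) $$ (i, j) = \<chi> W S * S $$ (i, j)"
      unfolding conj_PW_SS[OF assms(1) S] using assms SS_carrier[OF S] by simp
  qed
  finally show ?thesis .
qed

end

section \<open>Pure errors and orthogonality of their characters\<close>

locale stabilizer_code_pure_errors = stabilizer_code +
  fixes TT :: "complex mat set"
  assumes pure: "pure_errors d n SS TT"
begin

lemma TT_PW: "T \<in> TT \<Longrightarrow> T \<in> PW d n"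
  using pure by (auto simp: pure_errors_def)

lemma finite_TT: "finite TT"
  using finite_subset[OF _ finite_PW] TT_PW by blast

lemma ex_pure_error:
  assumes "W \<in> PW d n"
  shows "\<exists>T\<in>TT. \<forall>S\<in>SS. \<chi> T S = \<chi> W S"
proof -
  obtain T where "T \<in> TT" "(\<lambda>v. W *\<^sub>v v) ` codespace d n SS = (\<lambda>v. T *\<^sub>v v) ` codespace d n SS"
    using pure image_codespace_in_cospaces[OF assms] by (auto simp: pure_errors_def)
  then show ?thesis using phase_eq_if_image_eq[OF TT_PW assms] by metis
qed

text \<open>Equal phases give equal images of the codespace, and each cospace has only one
  label.\<close>

lemma pure_error_eqI:
  assumes "T \<in> TT" "T' \<in> TT" "\<And>S. S \<in> SS \<Longrightarrow> \<chi> T S = \<chi> T' S"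
  shows "T = T'"
proof -
  have "(\<lambda>v. T *\<^sub>v v) ` codespace d n SS = (\<lambda>v. T' *\<^sub>v v) ` codespace d n SS"
    using assms TT_PW by (intro image_eq_if_phase_eq)
  moreover have "\<exists>!T'. T' \<in> TT \<and> (\<lambda>v. T *\<^sub>v v) ` codespace d n SS = (\<lambda>v. T' *\<^sub>v v) ` codespace d n SS"
    using pure image_codespace_in_cospaces[OF TT_PW[OF assms(1)]] by (auto simp: pure_errors_def)
  ultimately show ?thesis using assms by blast
qed

text \<open>The product of two pure errors is a phase multiple of a third, and scalar factors do not
  change commutation phases.\<close>

lemma ex_pure_error_mult:
  assumes "T \<in> TT" "T' \<in> TT"
  shows "\<exists>T''\<in>TT. \<forall>S\<in>SS. \<chi> T'' S = \<chi> T S * \<chi> T' S"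
proof -
  have phase: "U \<in> phase_multiples TT" if "U \<in> TT" for U
    unfolding phase_multiples_def using that by (force intro: exI[of _ 1])
  have "group (op_ring d n\<lparr>carrier := phase_multiples TT\<rparr>)"
    using pure by (simp add: pure_errors_def)
  from monoid.m_closed[OF group.is_monoid[OF this]]
  have "T * T' \<in> phase_multiples TT"
    using phase assms by (simp add: ring_mat_simps)
  then obtain c T'' where T'': "T'' \<in> TT" "T * T' = c \<cdot>\<^sub>m T''" "cmod c = 1"
    by (auto simp: phase_multiples_def)
  have eq: "T'' = cnj c \<cdot>\<^sub>m (T * T')"
    using T'' by (simp add: cmod_one_cnj_mult)
  have "\<chi> T'' S = \<chi> T S * \<chi> T' S" if S: "S \<in> SS" for S
  proof (rule phase_eqI[OF TT_PW[OF T''(1)] S])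
    have "commute_up_to (\<chi> T S * \<chi> T' S) (T * T') S"
      using assms S by (intro commute_up_to_mult_left[where N = N] commute_up_to_phase
          PW_carrier TT_PW SS_carrier)
    moreover have "T * T' \<in> carrier_mat N N"
      using assms by (intro mult_carrier_mat[of _ N N] PW_carrier TT_PW)
    ultimately show "commute_up_to (\<chi> T S * \<chi> T' S) T'' S"
      unfolding eq using SS_carrier[OF S] by (intro commute_up_to_smult_left[where N = N])
  qed
  with T''(1) show ?thesis by blast
qed

text \<open>The translation argument again, now over the pure errors. As \<open>TT\<close> is closed
  only up to phases, multiplication by \<open>T0\<close> is replaced by a map \<open>f\<close> with
  the product phases; it is injective because phases determine a pure error.\<close>

lemma sum_TT_phase_eq_0:
  assumes "S \<in> SS" "S \<noteq> 1\<^sub>m N"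
  shows "(\<Sum>T\<in>TT. \<chi> T S) = 0"
proof -
  obtain W where "W \<in> PW d n" "\<chi> W S \<noteq> 1" using phase_separates[OF assms] by blast
  then obtain T0 where T0: "T0 \<in> TT" "\<chi> T0 S \<noteq> 1" using ex_pure_error assms(1) by metis
  obtain f where f: "\<And>T. T \<in> TT \<Longrightarrow> f T \<in> TT"
    "\<And>T S. T \<in> TT \<Longrightarrow> S \<in> SS \<Longrightarrow> \<chi> (f T) S = \<chi> T0 S * \<chi> T S"
    using ex_pure_error_mult[OF T0(1)] by metis
  have "inj_on f TT"
  proof (rule inj_onI)
    fix T T' assume T: "T \<in> TT" "T' \<in> TT" "f T = f T'"
    show "T = T'"
    proof (rule pure_error_eqI[OF T(1,2)])
      fix S' assume S': "S' \<in> SS"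
      have "\<chi> T0 S' * \<chi> T S' = \<chi> T0 S' * \<chi> T' S'" using f(2)[OF _ S'] T by metis
      moreover have "\<chi> T0 S' \<noteq> 0" using norm_phase[OF TT_PW[OF T0(1)] S'] by auto
      ultimately show "\<chi> T S' = \<chi> T' S'" by simp
    qed
  qed
  moreover have "f ` TT \<subseteq> TT" using f by auto
  ultimately have bij: "bij_betw f TT TT"
    using finite_TT by (simp add: bij_betw_def endo_inj_surj)
  have "(\<Sum>T\<in>TT. \<chi> T S) = (\<Sum>T\<in>TT. \<chi> (f T) S)"
    by (rule sum.reindex_bij_betw[OF bij, symmetric])
  also have "\<dots> = \<chi> T0 S * (\<Sum>T\<in>TT. \<chi> T S)"
    using f assms(1) by (simp add: sum_distrib_left)
  finally show ?thesis using T0(2) by simp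
qed

text \<open>Double counting of \<open>\<Sum>\<^sub>T \<Sum>\<^sub>S \<chi> T S\<close>: only the trivial character, respectively the identity, contributes.\<close>

lemma card_TT: "card TT = card SS"
proof -
  obtain T1 where T1: "T1 \<in> TT" "\<And>S. S \<in> SS \<Longrightarrow> \<chi> T1 S = \<chi> (1\<^sub>m N) S"
    using ex_pure_error[OF one_in_PW] by blast
  have one: "\<chi> (1\<^sub>m N) S = 1" if "S \<in> SS" for S
    using that by (intro phase_eqI one_in_PW commute_up_to_one_left SS_carrier)
  have inner: "(\<Sum>S\<in>SS. \<chi> T S) = (if T = T1 then of_nat (card SS) else 0)" if T: "T \<in> TT" for T
  proof (cases "T = T1")
    case True
    then show ?thesis using T1(2) one by simp
  next
    case False
    then obtain S where "S \<in> SS" "\<chi> T S \<noteq> 1"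
      using pure_error_eqI[OF T T1(1)] T1(2) one by metis
    then show ?thesis using False sum_SS_phase TT_PW T by simp
  qed
  have "(of_nat (card SS) :: complex) = (\<Sum>T\<in>TT. \<Sum>S\<in>SS. \<chi> T S)"
    using inner T1(1) finite_TT by simp
  also have "\<dots> = (\<Sum>S\<in>SS. \<Sum>T\<in>TT. \<chi> T S)" by (rule sum.swap)
  also have "\<dots> = (\<Sum>S\<in>SS. if S = 1\<^sub>m N then of_nat (card TT) else 0)"
    by (intro sum.cong refl) (auto simp: sum_TT_phase_eq_0 phase_one TT_PW)
  also have "\<dots> = of_nat (card TT)" using finite_SS one_in_SS by simp
  finally show ?thesis by (simp only: of_nat_eq_iff)
qed

text \<open>Since each \<open>\<chi> T\<close> is a character, the summand is
  \<open>\<chi> T\<close> at \<open>S * mat_adjoint S'\<close>. That element is the identity exactly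
  when \<open>S = S'\<close>; in that case the sum counts the pure errors.\<close>

lemma sum_TT_phase_cnj:
  assumes "S \<in> SS" "S' \<in> SS"
  shows "(\<Sum>T\<in>TT. \<chi> T S * cnj (\<chi> T S')) = (if S = S' then of_nat (card SS) else 0)"
proof -
  have S'': "S * mat_adjoint S' \<in> SS" using assms by (intro mult_in_SS adjoint_in_SS)
  have eq: "(\<Sum>T\<in>TT. \<chi> T S * cnj (\<chi> T S')) = (\<Sum>T\<in>TT. \<chi> T (S * mat_adjoint S'))"
    using assms by (intro sum.cong refl) (simp add: phase_mult phase_adjoint adjoint_in_SS TT_PW)
  show ?thesis
  proof (cases "S = S'")
    case True
    then have "S * mat_adjoint S' = 1\<^sub>m N" using unitary_op_SS assms by (simp add: unitary_op_def)
    then show ?thesis unfolding eq using True by (simp add: phase_one TT_PW card_TT)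
  next
    case False
    have "S * mat_adjoint S' \<noteq> 1\<^sub>m N"
    proof
      assume one: "S * mat_adjoint S' = 1\<^sub>m N"
      have c: "S \<in> carrier_mat N N" "S' \<in> carrier_mat N N" "mat_adjoint S' \<in> carrier_mat N N"
        using assms SS_carrier by auto
      have "S = S * (mat_adjoint S' * S')"
        using unitary_op_SS[OF assms(2)] c by (simp add: unitary_op_def)
      also have "\<dots> = (S * mat_adjoint S') * S'"
        using c by (simp add: square_mat_simps[where N = N])
      also have "\<dots> = S'" using one c by simp
      finally show False using False by simp
    qed
    then show ?thesis unfolding eq using sum_TT_phase_eq_0[OF S''] False by simp
  qed
qed

text \<open>The theorem at the level of coefficients. Expanding both projectors gives a double sum
  over stabilizers; summing over \<open>T\<close> first leaves its diagonal.\<close>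

lemma sum_cospace_proj_index:
  assumes "i < N" "j < N" "a < N" "b < N"
  shows "(\<Sum>T\<in>TT. cospace_proj d n SS T $$ (i, a) * cnj (cospace_proj d n SS T $$ (j, b))) =
    (1 / of_nat (card SS)) * (\<Sum>S\<in>SS. S $$ (i, a) * cnj (S $$ (j, b)))"
proof -
  let ?s = "1 / of_nat (card SS) :: complex"
  have "(\<Sum>T\<in>TT. cospace_proj d n SS T $$ (i, a) * cnj (cospace_proj d n SS T $$ (j, b))) =
      (\<Sum>T\<in>TT. (?s * (\<Sum>S\<in>SS. \<chi> T S * S $$ (i, a))) * (?s * (\<Sum>S\<in>SS. cnj (\<chi> T S) * cnj (S $$ (j, b)))))"
    using assms by (intro sum.cong refl) (simp add: cospace_proj_index TT_PW)
  also have "\<dots> = (\<Sum>T\<in>TT. \<Sum>S\<in>SS. \<Sum>S'\<in>SS.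
      ?s * ?s * (S $$ (i, a) * cnj (S' $$ (j, b))) * (\<chi> T S * cnj (\<chi> T S')))"
  proof (intro sum.cong refl)
    fix T
    let ?A = "\<Sum>S\<in>SS. \<chi> T S * S $$ (i, a)" and ?B = "\<Sum>S\<in>SS. cnj (\<chi> T S) * cnj (S $$ (j, b))"
    have "(?s * ?A) * (?s * ?B) = ?s * ?s * (?A * ?B)" by (simp only: mult_ac)
    also have "?A * ?B = (\<Sum>S\<in>SS. \<Sum>S'\<in>SS. \<chi> T S * S $$ (i, a) * (cnj (\<chi> T S') * cnj (S' $$ (j, b))))"
      by (rule sum_product)
    also have "?s * ?s * \<dots> = (\<Sum>S\<in>SS. \<Sum>S'\<in>SS.
        ?s * ?s * (S $$ (i, a) * cnj (S' $$ (j, b))) * (\<chi> T S * cnj (\<chi> T S')))"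
      by (simp only: sum_distrib_left mult_ac)
    finally show "(?s * ?A) * (?s * ?B) = (\<Sum>S\<in>SS. \<Sum>S'\<in>SS.
        ?s * ?s * (S $$ (i, a) * cnj (S' $$ (j, b))) * (\<chi> T S * cnj (\<chi> T S')))" .
  qed
  also have "\<dots> = (\<Sum>S\<in>SS. \<Sum>S'\<in>SS. \<Sum>T\<in>TT.
      ?s * ?s * (S $$ (i, a) * cnj (S' $$ (j, b))) * (\<chi> T S * cnj (\<chi> T S')))"
    by (subst sum.swap, rule sum.cong[OF refl], rule sum.swap)
  also have "\<dots> = (\<Sum>S\<in>SS. \<Sum>S'\<in>SS.
      ?s * ?s * (S $$ (i, a) * cnj (S' $$ (j, b))) * (if S = S' then of_nat (card SS) else 0))"
    by (intro sum.cong refl) (simp only: sum_distrib_left[symmetric] sum_TT_phase_cnj)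
  \<comment> \<open>The orthogonality value \<open>card SS\<close> cancels one of the two
    normalising factors.\<close>
  also have "\<dots> = (\<Sum>S\<in>SS. ?s * (S $$ (i, a) * cnj (S $$ (j, b))))"
  proof (rule sum.cong[OF refl])
    fix S assume S: "S \<in> SS"
    have "(\<Sum>S'\<in>SS. ?s * ?s * (S $$ (i, a) * cnj (S' $$ (j, b))) * (if S = S' then of_nat (card SS) else 0))
      = (\<Sum>S'\<in>SS. if S = S' then ?s * (S $$ (i, a) * cnj (S' $$ (j, b))) else 0)"
      using card_SS_pos by (intro sum.cong refl) simp
    also have "\<dots> = ?s * (S $$ (i, a) * cnj (S $$ (j, b)))"
      using S finite_SS by simp
    finally show "(\<Sum>S'\<in>SS. ?s * ?s * (S $$ (i, a) * cnj (S' $$ (j, b))) *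
        (if S = S' then of_nat (card SS) else 0)) = ?s * (S $$ (i, a) * cnj (S $$ (j, b)))" .
  qed
  finally show ?thesis by (simp only: sum_distrib_left)
qed

lemma average_eq_sum_cospaces:
  assumes \<rho>: "\<rho> \<in> carrier_mat N N"
  shows "(1 / of_nat (card SS)) \<cdot>\<^sub>m (\<Oplus>\<^bsub>op_ring d n\<^esub>S\<in>SS. conj_map S \<rho>)
    = (\<Oplus>\<^bsub>op_ring d n\<^esub>T\<in>TT. conj_map (cospace_proj d n SS T) \<rho>)"
    (is "?s \<cdot>\<^sub>m ?L = ?R")
proof (rule eq_matI)
  have SS: "conj_map S \<rho> \<in> carrier_mat N N" if "S \<in> SS" for S
    by (rule conj_map_carrier[OF SS_carrier[OF that] \<rho>])
  have TT: "conj_map (cospace_proj d n SS T) \<rho> \<in> carrier_mat N N" if "T \<in> TT" for T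
    using that \<rho> by (intro conj_map_carrier cospace_proj_carrier TT_PW)
  have L: "?L \<in> carrier_mat N N" by (intro finsum_ring_mat_carrier finite_SS SS)
  have R: "?R \<in> carrier_mat N N" by (intro finsum_ring_mat_carrier finite_TT TT)
  show "dim_row (?s \<cdot>\<^sub>m ?L) = dim_row ?R" "dim_col (?s \<cdot>\<^sub>m ?L) = dim_col ?R"
    using L R by auto
  fix i j assume "i < dim_row ?R" "j < dim_col ?R"
  then have ij: "i < N" "j < N" using R by auto
  have "?R $$ (i, j) = (\<Sum>T\<in>TT. conj_map (cospace_proj d n SS T) \<rho> $$ (i, j))"
    using ij TT finite_TT by (intro finsum_ring_mat_index)
  also have "\<dots> = (\<Sum>T\<in>TT. \<Sum>a = 0..<N. \<Sum>b = 0..<N.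
      cospace_proj d n SS T $$ (i, a) * \<rho> $$ (a, b) * cnj (cospace_proj d n SS T $$ (j, b)))"
    using ij \<rho> by (intro sum.cong refl conj_map_index cospace_proj_carrier TT_PW)
  also have "\<dots> = (\<Sum>a = 0..<N. \<Sum>b = 0..<N. \<Sum>T\<in>TT.
      cospace_proj d n SS T $$ (i, a) * \<rho> $$ (a, b) * cnj (cospace_proj d n SS T $$ (j, b)))"
    by (subst sum.swap, rule sum.cong[OF refl], rule sum.swap)
  \<comment> \<open>Isolating the entries of \<rho> exposes the coefficient sum that
    \<open>sum_cospace_proj_index\<close> evaluates.\<close>
  also have "\<dots> = (\<Sum>a = 0..<N. \<Sum>b = 0..<N. \<rho> $$ (a, b) *
      (\<Sum>T\<in>TT. cospace_proj d n SS T $$ (i, a) * cnj (cospace_proj d n SS T $$ (j, b))))"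
    by (simp only: sum_distrib_left mult_ac)
  also have "\<dots> = (\<Sum>a = 0..<N. \<Sum>b = 0..<N. \<rho> $$ (a, b) *
      (?s * (\<Sum>S\<in>SS. S $$ (i, a) * cnj (S $$ (j, b)))))"
    using ij by (intro sum.cong refl) (simp only: sum_cospace_proj_index atLeastLessThan_iff)
  also have "\<dots> = ?s * (\<Sum>a = 0..<N. \<Sum>b = 0..<N. \<Sum>S\<in>SS.
      S $$ (i, a) * \<rho> $$ (a, b) * cnj (S $$ (j, b)))"
    by (simp only: sum_distrib_left mult_ac)
  also have "(\<Sum>a = 0..<N. \<Sum>b = 0..<N. \<Sum>S\<in>SS. S $$ (i, a) * \<rho> $$ (a, b) * cnj (S $$ (j, b))) =
      (\<Sum>S\<in>SS. \<Sum>a = 0..<N. \<Sum>b = 0..<N. S $$ (i, a) * \<rho> $$ (a, b) * cnj (S $$ (j, b)))"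
    by (subst (2) sum.swap, rule sum.cong[OF refl], rule sum.swap)
  also have "\<dots> = (\<Sum>S\<in>SS. conj_map S \<rho> $$ (i, j))"
    using ij by (intro sum.cong refl conj_map_index[symmetric, OF SS_carrier \<rho>])
  also have "\<dots> = ?L $$ (i, j)"
    using ij SS finite_SS by (intro finsum_ring_mat_index[symmetric])
  finally show "(?s \<cdot>\<^sub>m ?L) $$ (i, j) = ?R $$ (i, j)"
    using ij L by (simp add: carrier_matD)
qed

end

theorem theorem1:
  fixes d n k :: nat and SS TT :: "complex mat set"
  assumes "d \<ge> 2" and "k \<le> n"
    and "stabilizer_group d n k SS"
    and "pure_errors d n SS TT"
  shows "\<forall>\<rho> \<in> carrier_mat (d ^ n) (d ^ n).
      (1 / of_nat (card SS)) \<cdot>\<^sub>m (\<Oplus>\<^bsub>op_ring d n\<^esub>S\<in>SS. conj_map S \<rho>)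
        = (\<Oplus>\<^bsub>op_ring d n\<^esub>T\<in>TT. conj_map (cospace_proj d n SS T) \<rho>) \<and>
      (1 / of_nat (card SS)) \<cdot>\<^sub>m (\<Oplus>\<^bsub>op_ring d n\<^esub>S\<in>SS. S * \<rho> * mat_adjoint S)
        = (\<Oplus>\<^bsub>op_ring d n\<^esub>T\<in>TT. cospace_proj d n SS T * \<rho> * cospace_proj d n SS T)"
proof
  interpret stabilizer_code_pure_errors d n k SS TT
    using assms by unfold_locales
  fix \<rho> :: "complex mat" assume \<rho>: "\<rho> \<in> carrier_mat (d ^ n) (d ^ n)"
  interpret R: ring "op_ring d n" by (rule ring_mat)
  \<comment> \<open>The second form of the theorem follows from the first because the cospace
    projectors are self-adjoint.\<close>
  have "(\<Oplus>\<^bsub>op_ring d n\<^esub>T\<in>TT. conj_map (cospace_proj d n SS T) \<rho>) =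
      (\<Oplus>\<^bsub>op_ring d n\<^esub>T\<in>TT. cospace_proj d n SS T * \<rho> * cospace_proj d n SS T)"
  proof (rule R.finsum_cong')
    show "(\<lambda>T. cospace_proj d n SS T * \<rho> * cospace_proj d n SS T) \<in> TT \<rightarrow> carrier (op_ring d n)"
      using \<rho> by (auto simp: ring_mat_simps intro!: mult_carrier_mat[of _ "d ^ n" "d ^ n"]
          cospace_proj_carrier TT_PW)
  qed (auto simp: conj_map_def cospace_proj_adjoint TT_PW)
  with average_eq_sum_cospaces[OF \<rho>]
  show "(1 / of_nat (card SS)) \<cdot>\<^sub>m (\<Oplus>\<^bsub>op_ring d n\<^esub>S\<in>SS. conj_map S \<rho>)
        = (\<Oplus>\<^bsub>op_ring d n\<^esub>T\<in>TT. conj_map (cospace_proj d n SS T) \<rho>) \<and>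
      (1 / of_nat (card SS)) \<cdot>\<^sub>m (\<Oplus>\<^bsub>op_ring d n\<^esub>S\<in>SS. S * \<rho> * mat_adjoint S)
        = (\<Oplus>\<^bsub>op_ring d n\<^esub>T\<in>TT. cospace_proj d n SS T * \<rho> * cospace_proj d n SS T)"
    by (simp add: conj_map_def)
qed

end
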